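(* As $n\to\infty$, $$(1+o(1))\frac{n}{2}\le g_{\mathrm{ECB}}(n,K_3)\le (1+o(1))\frac{2n}{3}.$$
   Context: Embedded Constructor-Blocker game: the vertices of $K_n$ are placed at the $n$-th roots of unity in the complex plane, and each edge is drawn as the straight chord inside the unit disk between its endpoints. Constructor and Blocker alternately claim previously unclaimed edges, Constructor moving first. Constructor may only claim an edge whose chord does not cross (in an interior point) any chord she has already claimed; Blocker may claim any unclaimed edge. The game ends when Constructor cannot claim any more edges or all edges are claimed. The score is the number of triangles in Constructor's graph at the end; Constructor maximizes it, Blocker minimizes it. $g_{\mathrm{ECB}}(n,K_3)$ denotes the score under optimal play. *)

theory Defs
  imports "HOL-Analysis.Analysis"
begin

definition vtx :: "nat \<Rightarrow> nat \<Rightarrow> complex" where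
  "vtx n k = cis (2 * pi * real k / real n)"

definition ecb_edges :: "nat \<Rightarrow> nat set set" where
  "ecb_edges n = {e. e \<subseteq> {..<n} \<and> card e = 2}"

definition chords_cross :: "nat \<Rightarrow> nat set \<Rightarrow> nat set \<Rightarrow> bool" where
  "chords_cross n e f \<longleftrightarrow> (\<exists>a b c d. e = {a, b} \<and> f = {c, d} \<and>
     open_segment (vtx n a) (vtx n b) \<inter> open_segment (vtx n c) (vtx n d) \<noteq> {})"

text \<open>Unclaimed edges Constructor may legally claim (C: Constructor's edges, B: Blocker's).\<close>
definition legalC :: "nat \<Rightarrow> nat set set \<Rightarrow> nat set set \<Rightarrow> nat set set" where
  "legalC n C B = {e \<in> ecb_edges n - C - B. \<forall>f\<in>C. \<not> chords_cross n e f}"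

definition triangles :: "nat \<Rightarrow> nat set set \<Rightarrow> nat" where
  "triangles n C = card {T. T \<subseteq> {..<n} \<and> card T = 3 \<and>
      (\<forall>e. e \<subseteq> T \<and> card e = 2 \<longrightarrow> e \<in> C)}"

text \<open>Value of the game under optimal play; the first argument k is the number of
  still unclaimed edges (fuel), the boolean says whether it is Constructor's turn.\<close>
fun ecb_val :: "nat \<Rightarrow> nat \<Rightarrow> bool \<Rightarrow> nat set set \<Rightarrow> nat set set \<Rightarrow> nat" where
  "ecb_val n 0 t C B = triangles n C"
| "ecb_val n (Suc k) True C B =
     (if legalC n C B = {} then triangles n C
      else Max ((\<lambda>e. ecb_val n k False (insert e C) B) ` legalC n C B))"
| "ecb_val n (Suc k) False C B =
     (if legalC n C B = {} \<or> ecb_edges n - C - B = {} then triangles n C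
      else Min ((\<lambda>e. ecb_val n k True C (insert e B)) ` (ecb_edges n - C - B)))"

definition g_ECB_K3 :: "nat \<Rightarrow> nat" where
  "g_ECB_K3 n = ecb_val n (card (ecb_edges n)) True {} {}"

end

theory Submission
  imports Defs
begin

text \<open>Two chords cross iff their endpoints interleave. In a noncrossing graph a triangle
  \<open>a < b < c\<close> is determined by its middle vertex \<open>b\<close>, and \<open>b\<close>, \<open>b + 1\<close> are not both middle
  vertices unless the side \<open>{b, b + 1}\<close> is present.

  Upper bound: sweeping along the circle, Blocker takes about \<open>n/3\<close> pairwise disjoint sides, and
  each of them costs Constructor one middle vertex.

  Lower bound: Constructor grows a convex polygon \<open>S\<close> upwards from the vertex \<open>0\<close> to its top \<open>m\<close>,
  using only vertices that are fresh, that is, not yet touched by Blocker. When Blocker takes a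
  diagonal of \<open>S\<close>, she answers with a diagonal crossing it, so that Blocker's diagonals never
  obstruct a triangulation of \<open>S\<close>. Any other move of Blocker costs at most one unit of the credit
  \<open>|F| + 2 |S| - 2 |gaps| + [base {0, m} not blocked] + [gap at m still open]\<close>, where \<open>F\<close> is a set
  of fresh vertices, and she has a move that gains one unit: close the gap at \<open>m\<close>; otherwise
  append a fresh vertex \<open>z\<close> by the side \<open>{m, z}\<close>, or, if the base is blocked, cross it by joining
  \<open>z\<close> to the lowest neighbour of \<open>m\<close>, which leaves the gap \<open>{m, z}\<close>. When \<open>F\<close> is exhausted,
  \<open>2 |S| - 2 |gaps|\<close> is at least \<open>n\<close>, and triangulating \<open>S\<close> gives almost \<open>n/2\<close> triangles.\<close>

section \<open>Chords of the regular polygon\<close>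

text \<open>The line through the vertices \<open>a\<close> and \<open>b\<close> has the unit normal \<open>cis (\<pi> (a + b) / n)\<close> and
  signed distance \<open>cos (\<pi> (b - a) / n)\<close> from the origin.\<close>
definition chord_form :: "nat \<Rightarrow> nat \<Rightarrow> nat \<Rightarrow> complex \<Rightarrow> real" where
  "chord_form n a b z =
     cis (pi * (real a + real b) / real n) \<bullet> z - cos (pi * (real b - real a) / real n)"

lemma chord_form_convex_combination:
  "chord_form n a b ((1 - t) *\<^sub>R x + t *\<^sub>R y) =
     (1 - t) * chord_form n a b x + t * chord_form n a b y"
  by (simp add: chord_form_def inner_add_right algebra_simps)

lemma chord_form_vtx:
  "chord_form n a b (vtx n k) =
     - 2 * sin (pi * (real k - real a) / n) * sin (pi * (real k - real b) / n)"
proof -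
  have "chord_form n a b (vtx n k)
      = cos (2 * pi * k / n - pi * (real a + real b) / n) - cos (pi * (real b - real a) / n)"
    by (simp add: chord_form_def vtx_def inner_complex_def cos_diff mult.commute)
  also have "2 * pi * k / n - pi * (real a + real b) / n
      = pi * (real k - real a) / n + pi * (real k - real b) / n"
    by (simp add: field_simps diff_divide_distrib add_divide_distrib)
  also have "pi * (real b - real a) / n = pi * (real k - real a) / n - pi * (real k - real b) / n"
    by (simp add: field_simps diff_divide_distrib add_divide_distrib)
  finally show ?thesis by (simp add: cos_add cos_diff)
qed

lemma chord_form_endpoints [simp]:
  "chord_form n a b (vtx n a) = 0" "chord_form n a b (vtx n b) = 0"
  by (simp_all add: chord_form_vtx)

lemma sin_pi_fraction_pos:
  assumes "0 < x" "x < y" shows "0 < sin (pi * x / y)"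
proof (rule sin_gt_zero)
  show "0 < pi * x / y" using assms by simp
  show "pi * x / y < pi" using assms by (simp add: field_simps)
qed

lemma sin_pi_fraction_neg:
  assumes "x < 0" "- x < y" shows "sin (pi * x / y) < 0"
  using sin_pi_fraction_pos[of "-x" y] assms by simp

lemma chord_form_vtx_pos:
  assumes "a < k" "k < b" "b < n" shows "0 < chord_form n a b (vtx n k)"
proof -
  have "0 < sin (pi * (real k - real a) / n)" by (rule sin_pi_fraction_pos) (use assms in auto)
  moreover have "sin (pi * (real k - real b) / n) < 0"
    by (rule sin_pi_fraction_neg) (use assms in auto)
  ultimately show ?thesis by (simp add: chord_form_vtx mult_pos_neg)
qed

lemma chord_form_vtx_neg:
  assumes "k < a \<or> b < k" "a < b" "b < n" "k < n" shows "chord_form n a b (vtx n k) < 0"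
proof -
  have "0 < sin (pi * (real k - real a) / n) * sin (pi * (real k - real b) / n)"
    using assms(1)
  proof
    assume "k < a"
    then show ?thesis by (intro mult_neg_neg sin_pi_fraction_neg) (use assms in auto)
  next
    assume "b < k"
    then show ?thesis by (intro mult_pos_pos sin_pi_fraction_pos) (use assms in auto)
  qed
  then show ?thesis by (simp add: chord_form_vtx)
qed

lemma chord_form_zero_on_chord:
  assumes "z \<in> open_segment (vtx n a) (vtx n b)" shows "chord_form n a b z = 0"
  using assms by (auto simp: in_segment chord_form_convex_combination)

lemma chord_form_nonzero_on_segment:
  assumes "z \<in> open_segment x y" "0 \<le> chord_form n a b x * chord_form n a b y"
    and "chord_form n a b x \<noteq> 0 \<or> chord_form n a b y \<noteq> 0"
  shows "chord_form n a b z \<noteq> 0"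
proof
  assume zero: "chord_form n a b z = 0"
  define u v where "u = chord_form n a b x" and "v = chord_form n a b y"
  obtain t where t: "0 < t" "t < 1" "z = (1 - t) *\<^sub>R x + t *\<^sub>R y"
    using assms(1) by (auto simp: in_segment)
  have combination: "(1 - t) * u + t * v = 0"
    using zero by (simp add: t(3) chord_form_convex_combination u_def v_def)
  have "(1 - t) * (u * u) + t * (u * v) = u * ((1 - t) * u + t * v)" by (simp add: algebra_simps)
  then have "(1 - t) * (u * u) + t * (u * v) = 0" by (simp add: combination)
  moreover have "0 \<le> (1 - t) * (u * u)" "0 \<le> t * (u * v)"
    using t assms(2) by (simp_all add: u_def v_def)
  ultimately have "(1 - t) * (u * u) = 0" by linarith
  then have "u = 0" using t by simp
  then have "v = 0" using combination t by simp
  then show False using \<open>u = 0\<close> assms(3) by (simp add: u_def v_def)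
qed

lemma chord_form_zero_on_separated_segment:
  assumes "0 < chord_form n a b x" "chord_form n a b y < 0"
  obtains z where "z \<in> open_segment x y" "chord_form n a b z = 0"
proof -
  define t where "t = chord_form n a b x / (chord_form n a b x - chord_form n a b y)"
  have t: "0 < t" "t < 1" using assms by (auto simp: t_def field_simps)
  have "x \<noteq> y" using assms by auto
  then have "(1 - t) *\<^sub>R x + t *\<^sub>R y \<in> open_segment x y" using t by (auto simp: in_segment)
  moreover have "chord_form n a b ((1 - t) *\<^sub>R x + t *\<^sub>R y) = 0"
    unfolding chord_form_convex_combination t_def using assms by (simp add: field_simps)
  ultimately show ?thesis by (rule that)
qed

lemma chords_cross_iff_segments_meet:
  "chords_cross n {a, b} {c, d} \<longleftrightarrow>
     open_segment (vtx n a) (vtx n b) \<inter> open_segment (vtx n c) (vtx n d) \<noteq> {}"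
  (is "?cross \<longleftrightarrow> ?meet")
proof
  show "?meet \<Longrightarrow> ?cross" unfolding chords_cross_def by blast
  assume ?cross
  then obtain a' b' c' d' where "{a, b} = {a', b'}" "{c, d} = {c', d'}"
    and meet: "open_segment (vtx n a') (vtx n b') \<inter> open_segment (vtx n c') (vtx n d') \<noteq> {}"
    unfolding chords_cross_def by blast
  then have "open_segment (vtx n a) (vtx n b) = open_segment (vtx n a') (vtx n b')"
    "open_segment (vtx n c) (vtx n d) = open_segment (vtx n c') (vtx n d')"
    unfolding doubleton_eq_iff by (auto simp: open_segment_commute)
  with meet show ?meet by (simp only:) simp
qed

lemma chords_cross_commute: "chords_cross n e f \<longleftrightarrow> chords_cross n f e"
  unfolding chords_cross_def by (metis Int_commute)

definition interleaved :: "'a::linorder \<Rightarrow> 'a \<Rightarrow> 'a \<Rightarrow> 'a \<Rightarrow> bool" where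
  "interleaved a b c d \<longleftrightarrow> a < c \<and> c < b \<and> b < d \<or> c < a \<and> a < d \<and> d < b"

lemma interleaved_commute: "interleaved a b c d \<longleftrightarrow> interleaved c d a b"
  by (auto simp: interleaved_def)

lemma not_chords_cross_if_not_interleaved:
  assumes "a < b" "b < n" "c < d" "d < n" "{a, b} \<noteq> {c, d}" "\<not> interleaved a b c d"
  shows "\<not> chords_cross n {a, b} {c, d}"
proof -
  have inside: "0 \<le> chord_form n a b (vtx n k)" if "a \<le> k" "k \<le> b" for k
    using chord_form_vtx_pos[of a k b n] that assms(2) by (cases "k = a"; cases "k = b") auto
  have outside: "chord_form n a b (vtx n k) \<le> 0" if "k \<le> a \<or> b \<le> k" "k < n" for k
    using chord_form_vtx_neg[of k a b n] that assms(1,2) by (cases "k = a"; cases "k = b") auto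
  have off_line: "chord_form n a b (vtx n k) \<noteq> 0" if "k \<noteq> a" "k \<noteq> b" "k < n" for k
    using chord_form_vtx_pos[of a k b n] chord_form_vtx_neg[of k a b n] that assms(1,2)
    by (metis less_numeral_extra(3) linorder_neqE_nat)
  have "a \<le> c \<and> d \<le> b \<or> (c \<le> a \<or> b \<le> c) \<and> (d \<le> a \<or> b \<le> d)"
    using assms(6) unfolding interleaved_def by linarith
  then have same_side: "0 \<le> chord_form n a b (vtx n c) * chord_form n a b (vtx n d)"
    using inside[of c] inside[of d] outside[of c] outside[of d] assms(3,4)
    by (auto intro: mult_nonneg_nonneg mult_nonpos_nonpos)
  have "c \<noteq> a \<and> c \<noteq> b \<or> d \<noteq> a \<and> d \<noteq> b" using assms(3,5) by (auto simp: insert_commute)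
  then have "chord_form n a b (vtx n c) \<noteq> 0 \<or> chord_form n a b (vtx n d) \<noteq> 0"
    using off_line assms(3,4) by (meson less_trans)
  then show ?thesis
    unfolding chords_cross_iff_segments_meet
    using chord_form_zero_on_chord chord_form_nonzero_on_segment[OF _ same_side] by blast
qed

lemma eq_zero_if_orthogonal_to_two_directions:
  assumes "cis \<alpha> \<bullet> z = 0" "cis \<beta> \<bullet> z = 0" "sin (\<beta> - \<alpha>) \<noteq> 0"
  shows "z = 0"
proof -
  have "Re z * sin (\<beta> - \<alpha>) = sin \<beta> * (cis \<alpha> \<bullet> z) - sin \<alpha> * (cis \<beta> \<bullet> z)"
    "Im z * sin (\<beta> - \<alpha>) = cos \<alpha> * (cis \<beta> \<bullet> z) - cos \<beta> * (cis \<alpha> \<bullet> z)"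
    by (simp_all add: inner_complex_def sin_diff algebra_simps)
  then show ?thesis using assms by (simp add: complex_eq_iff)
qed

lemma chords_cross_if_separated:
  assumes "a < c" "c < b" "b < d" "d < n"
  shows "chords_cross n {a, b} {c, d}"
proof -
  obtain z where z: "z \<in> open_segment (vtx n c) (vtx n d)" "chord_form n a b z = 0"
    using chord_form_zero_on_separated_segment[OF chord_form_vtx_pos[of a c b n]
        chord_form_vtx_neg[of d a b n]] assms by auto
  obtain w where "w \<in> open_segment (vtx n b) (vtx n a)" and w_cd: "chord_form n c d w = 0"
    using chord_form_zero_on_separated_segment[OF chord_form_vtx_pos[of c b d n]
        chord_form_vtx_neg[of a c d n]] assms by auto
  then have w: "w \<in> open_segment (vtx n a) (vtx n b)" by (simp add: open_segment_commute)
  have "cis (pi * (real a + real b) / n) \<bullet> (z - w) = 0"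
    using z(2) chord_form_zero_on_chord[OF w] by (simp add: chord_form_def inner_diff_right)
  moreover have "cis (pi * (real c + real d) / n) \<bullet> (z - w) = 0"
    using w_cd chord_form_zero_on_chord[OF z(1)] by (simp add: chord_form_def inner_diff_right)
  moreover have "sin (pi * (real c + real d) / n - pi * (real a + real b) / n) > 0"
    using sin_pi_fraction_pos[of "real c + real d - real a - real b" n] assms
    by (simp add: right_diff_distrib diff_divide_distrib add_divide_distrib algebra_simps)
  ultimately have "z - w = 0" by (metis eq_zero_if_orthogonal_to_two_directions less_irrefl)
  then show ?thesis unfolding chords_cross_iff_segments_meet using z(1) w by auto
qed

lemma chords_cross_iff_interleaved:
  assumes "a < b" "b < n" "c < d" "d < n" "{a, b} \<noteq> {c, d}"
  shows "chords_cross n {a, b} {c, d} \<longleftrightarrow> interleaved a b c d"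
  using not_chords_cross_if_not_interleaved[OF assms] chords_cross_if_separated[of a c b d n]
    chords_cross_if_separated[of c a d b n] chords_cross_commute assms
  unfolding interleaved_def by metis

section \<open>Noncrossing graphs on an ordered vertex set\<close>

definition uncrossed :: "'a::linorder set set \<Rightarrow> 'a \<Rightarrow> 'a \<Rightarrow> bool" where
  "uncrossed C a b \<longleftrightarrow> (\<forall>c d. {c, d} \<in> C \<longrightarrow> \<not> interleaved a b c d)"

definition noncrossing :: "'a::linorder set set \<Rightarrow> bool" where
  "noncrossing C \<longleftrightarrow> (\<forall>a b. {a, b} \<in> C \<longrightarrow> uncrossed C a b)"

lemma noncrossingD:
  "noncrossing C \<Longrightarrow> {a, b} \<in> C \<Longrightarrow> {c, d} \<in> C \<Longrightarrow> \<not> interleaved a b c d"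
  unfolding noncrossing_def uncrossed_def by blast

lemma uncrossed_antimono: "uncrossed C' a b \<Longrightarrow> C \<subseteq> C' \<Longrightarrow> uncrossed C a b"
  unfolding uncrossed_def by blast

lemma uncrossed_insert_iff:
  assumes "x < y"
  shows "uncrossed (insert {x, y} C) a b \<longleftrightarrow> uncrossed C a b \<and> \<not> interleaved a b x y"
proof -
  have "\<not> interleaved a b y x" using assms by (auto simp: interleaved_def)
  then show ?thesis unfolding uncrossed_def by (auto simp: doubleton_eq_iff)
qed

lemma noncrossing_insert:
  assumes "noncrossing C" "x < y" "uncrossed C x y"
  shows "noncrossing (insert {x, y} C)"
proof -
  have "uncrossed C a b \<and> \<not> interleaved a b x y" if "{a, b} \<in> insert {x, y} C" for a b
  proof (cases "{a, b} = {x, y}")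
    case True
    then consider "a = x" "b = y" | "a = y" "b = x" by (auto simp: doubleton_eq_iff)
    then show ?thesis
      using assms(2,3) by cases (auto simp: interleaved_def uncrossed_def)
  next
    case False
    then have "{a, b} \<in> C" using that by simp
    then show ?thesis
      using assms(1,3) interleaved_commute[of a b] unfolding noncrossing_def uncrossed_def by blast
  qed
  then show ?thesis unfolding noncrossing_def uncrossed_insert_iff[OF assms(2)] by blast
qed

lemma uncrossed_consecutive_neighbours:
  assumes "noncrossing C" "a < x" "x < y" "{a, x} \<in> C" "{a, y} \<in> C"
    and none_between: "\<And>w. x < w \<Longrightarrow> w < y \<Longrightarrow> {a, w} \<notin> C"
  shows "uncrossed C x y"
  unfolding uncrossed_def
proof (intro allI impI)
  fix c d assume cd: "{c, d} \<in> C"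
  have "\<not> interleaved a x c d" "\<not> interleaved a y c d"
    using assms(1,4,5) cd by (auto dest: noncrossingD)
  moreover have "\<not> (c = a \<and> x < d \<and> d < y)" using cd none_between by blast
  ultimately show "\<not> interleaved x y c d" using assms(2,3) unfolding interleaved_def
    by (cases c a rule: linorder_cases; cases d a rule: linorder_cases)
      (auto dest: order.strict_trans)
qed

lemma uncrossed_extreme_neighbours:
  assumes "noncrossing C" "p < a" "a < q" "{p, a} \<in> C" "{a, q} \<in> C"
    and lowest: "\<And>w. w < p \<Longrightarrow> {w, a} \<notin> C" and highest: "\<And>w. q < w \<Longrightarrow> {a, w} \<notin> C"
  shows "uncrossed C p q"
  unfolding uncrossed_def
proof (intro allI impI)
  fix c d assume cd: "{c, d} \<in> C"
  have "\<not> interleaved p a c d" "\<not> interleaved a q c d"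
    using assms(1,4,5) cd by (auto dest: noncrossingD)
  moreover have "\<not> (c = a \<and> q < d)" "\<not> (d = a \<and> c < p)" using cd lowest highest by blast+
  ultimately show "\<not> interleaved p q c d" using assms(2,3) unfolding interleaved_def
    by (cases c a rule: linorder_cases; cases d a rule: linorder_cases)
      (auto dest: order.strict_trans)
qed

lemma uncrossed_pair_crossing_at_vertex:
  assumes noncrossing: "noncrossing C" and fin: "finite {w. {a, w} \<in> C}" and ab: "{a, b} \<notin> C"
    and inner: "{a, u} \<in> C" "a < u" "u < b" and outer: "{a, v} \<in> C" "v < a"
  obtains x y where "{a, x} \<in> C" "{a, y} \<in> C" "uncrossed C x y" "interleaved a b x y"
proof -
  have finite_nbrs: "finite {w. {a, w} \<in> C \<and> P w}" for P using fin by (rule rev_finite_subset) auto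
  obtain x where x: "{a, x} \<in> C" "a < x" "x < b"
    and x_max: "\<And>w. {a, w} \<in> C \<Longrightarrow> a < w \<Longrightarrow> w < b \<Longrightarrow> w \<le> x"
    using finite_has_maximal[OF finite_nbrs[of "\<lambda>w. a < w \<and> w < b"]] inner
    by (auto dest!: leI) (metis linorder_linear order_less_imp_le)
  show ?thesis
  proof (cases "\<exists>y. {a, y} \<in> C \<and> b < y")
    case True
    then obtain y where y: "{a, y} \<in> C" "b < y" "\<And>w. {a, w} \<in> C \<Longrightarrow> b < w \<Longrightarrow> y \<le> w"
      using finite_has_minimal[OF finite_nbrs[of "\<lambda>w. b < w"]]
      by auto (metis linorder_linear)
    have "{a, w} \<notin> C" if "x < w" "w < y" for w
      using x_max[of w] y(3)[of w] x(2) that ab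
      by (metis linorder_less_linear not_less order_less_trans)
    then have "uncrossed C x y"
      using x y(1,2) by (intro uncrossed_consecutive_neighbours[OF noncrossing, of a]) auto
    then show ?thesis using x y(1,2) by (intro that) (auto simp: interleaved_def)
  next
    case False
    obtain p where p: "{a, p} \<in> C" "p < a" "\<And>w. {a, w} \<in> C \<Longrightarrow> w < a \<Longrightarrow> p \<le> w"
      using finite_has_minimal[OF finite_nbrs[of "\<lambda>w. w < a"]] outer
      by auto (metis linorder_linear)
    have "{w, a} \<notin> C" if "w < p" for w
      using p(3)[of w] that p(2) by (metis insert_commute not_less order.strict_trans)
    moreover have "{a, w} \<notin> C" if "x < w" for w
      using x_max[of w] x(2) that ab False
      by (metis linorder_less_linear not_less order_less_trans)
    ultimately have "uncrossed C p x"
      using x p(1,2) by (intro uncrossed_extreme_neighbours[OF noncrossing, of p a])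
        (auto simp: insert_commute)
    then show ?thesis using x p(1,2) by (intro that) (auto simp: interleaved_def)
  qed
qed

definition triangle :: "'a::linorder set set \<Rightarrow> 'a \<Rightarrow> 'a \<Rightarrow> 'a \<Rightarrow> bool" where
  "triangle C a b c \<longleftrightarrow> a < b \<and> b < c \<and> {a, b} \<in> C \<and> {b, c} \<in> C \<and> {a, c} \<in> C"

definition middle :: "'a::linorder set set \<Rightarrow> 'a \<Rightarrow> bool" where
  "middle C b \<longleftrightarrow> (\<exists>a c. triangle C a b c)"

lemma triangle_determined_by_middle:
  assumes "noncrossing C" "triangle C a b c" "triangle C a' b c'"
  shows "a = a' \<and> c = c'"
proof -
  have "\<not> interleaved a b a' c'" "\<not> interleaved a' b a c"
    "\<not> interleaved a c b c'" "\<not> interleaved a' c' b c"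
    using assms by (auto simp: triangle_def dest: noncrossingD)
  then have "\<not> a < a'" "\<not> a' < a" "\<not> c < c'" "\<not> c' < c"
    using assms(2,3) unfolding triangle_def interleaved_def by blast+
  then show ?thesis by (meson linorder_neqE)
qed

lemma increasing_triple_eq_iff:
  fixes a b c :: "'a::linorder"
  assumes "a < b" "b < c" "a' < b'" "b' < c'"
  shows "{a, b, c} = {a', b', c'} \<longleftrightarrow> a = a' \<and> b = b' \<and> c = c'"
proof
  assume "{a, b, c} = {a', b', c'}"
  then have "set [a, b, c] = set [a', b', c']" by simp
  moreover have "sorted_wrt (<) [a, b, c]" "sorted_wrt (<) [a', b', c']" using assms by auto
  ultimately have "[a, b, c] = [a', b', c']" by (metis strict_sorted_equal)
  then show "a = a' \<and> b = b' \<and> c = c'" by simp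
qed simp

lemma card_3_increasing:
  fixes T :: "'a::linorder set"
  assumes "card T = 3"
  obtains a b c where "T = {a, b, c}" "a < b" "b < c"
proof -
  define xs where "xs = sorted_list_of_set T"
  have "finite T" using assms by (intro card_ge_0_finite) auto
  then have xs: "length xs = 3" "sorted_wrt (<) xs" "set xs = T" using assms by (auto simp: xs_def)
  then obtain a b c where "xs = [a, b, c]" by (auto simp: numeral_3_eq_3 length_Suc_conv)
  then show ?thesis using that xs(2,3) by auto
qed

lemma pair_in_ecb_edges_iff: "{a, b} \<in> ecb_edges n \<longleftrightarrow> a \<noteq> b \<and> a < n \<and> b < n"
  by (auto simp: ecb_edges_def card_2_iff doubleton_eq_iff)

lemma ecb_edgesE:
  assumes "e \<in> ecb_edges n"
  obtains a b where "e = {a, b}" "a < b" "b < n"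
proof -
  obtain a b where "e = {a, b}" "a \<noteq> b" using assms by (auto simp: ecb_edges_def card_2_iff)
  then show ?thesis using that[of a b] that[of b a] assms
    by (cases "a < b") (auto simp: insert_commute pair_in_ecb_edges_iff)
qed

lemma finite_ecb_edges [simp]: "finite (ecb_edges n)"
  by (rule finite_subset[of _ "Pow {..<n}"]) (auto simp: ecb_edges_def)

lemma triangle_set_eq:
  assumes "C \<subseteq> ecb_edges n"
  shows "{T. T \<subseteq> {..<n} \<and> card T = 3 \<and> (\<forall>e. e \<subseteq> T \<and> card e = 2 \<longrightarrow> e \<in> C)}
       = (\<lambda>(a, b, c). {a, b, c}) ` {(a, b, c). triangle C a b c}"
    (is "?sets = ?triples")
proof
  show "?sets \<subseteq> ?triples"
  proof clarify
    fix T assume "card T = 3" and edges: "\<forall>e. e \<subseteq> T \<and> card e = 2 \<longrightarrow> e \<in> C"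
    then obtain a b c where abc: "T = {a, b, c}" "a < b" "b < c" by (metis card_3_increasing)
    then have "triangle C a b c" using edges by (auto simp: triangle_def)
    then show "T \<in> ?triples" using abc(1) by force
  qed
  show "?triples \<subseteq> ?sets"
  proof clarsimp
    fix a b c assume "triangle C a b c"
    then have abc: "a < b" "b < c" "{a, b} \<in> C" "{b, c} \<in> C" "{a, c} \<in> C"
      by (simp_all add: triangle_def)
    have "e \<in> C" if "e \<subseteq> {a, b, c}" "card e = 2" for e
    proof -
      obtain x y where "e = {x, y}" "x \<noteq> y" using \<open>card e = 2\<close> by (auto simp: card_2_iff)
      then show ?thesis using that(1) abc by (auto simp: insert_commute)
    qed
    moreover have "a < n" "b < n" "c < n" using abc assms pair_in_ecb_edges_iff by blast+
    ultimately show "a < n \<and> b < n \<and> c < n \<and> card {a, b, c} = 3 \<and>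
        (\<forall>e. e \<subseteq> {a, b, c} \<and> card e = 2 \<longrightarrow> e \<in> C)"
      using abc by auto
  qed
qed

lemma triangles_eq_card_middle:
  assumes "C \<subseteq> ecb_edges n" "noncrossing C"
  shows "triangles n C = card {b. middle C b}"
proof -
  have "inj_on (\<lambda>(a, b, c). {a, b, c}) {(a, b, c). triangle C a b c}"
    by (auto simp: inj_on_def triangle_def increasing_triple_eq_iff)
  then have "triangles n C = card {(a, b, c). triangle C a b c}"
    unfolding triangles_def triangle_set_eq[OF assms(1)] by (rule card_image)
  moreover have "inj_on (\<lambda>(a, b, c). b) {(a, b, c). triangle C a b c}"
    by (auto simp: inj_on_def dest: triangle_determined_by_middle[OF assms(2)])
  then have "card ((\<lambda>(a, b, c). b) ` {(a, b, c). triangle C a b c}) =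
      card {(a, b, c). triangle C a b c}"
    by (rule card_image)
  moreover have "(\<lambda>(a, b, c). b) ` {(a, b, c). triangle C a b c} = {b. middle C b}"
    by (force simp: middle_def)
  ultimately show ?thesis by simp
qed

lemma middle_less:
  assumes "C \<subseteq> ecb_edges n" "middle C b" shows "b < n"
  using assms unfolding middle_def triangle_def by (meson pair_in_ecb_edges_iff subsetD)

section \<open>Positions and their values\<close>

lemma pair_in_legalC_iff:
  assumes "C \<subseteq> ecb_edges n" "x < y"
  shows "{x, y} \<in> legalC n C B \<longleftrightarrow> y < n \<and> {x, y} \<notin> C \<and> {x, y} \<notin> B \<and> uncrossed C x y"
proof -
  have "(\<forall>f\<in>C. \<not> chords_cross n {x, y} f) \<longleftrightarrow> uncrossed C x y" if "y < n" "{x, y} \<notin> C"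
  proof
    assume no_cross: "\<forall>f\<in>C. \<not> chords_cross n {x, y} f"
    have "\<not> interleaved x y c d" if cd: "{c, d} \<in> C" for c d
    proof
      assume "interleaved x y c d"
      moreover from this have "c < d" by (auto simp: interleaved_def)
      moreover have "d < n" using assms(1) cd pair_in_ecb_edges_iff by blast
      moreover have "{x, y} \<noteq> {c, d}" using cd \<open>{x, y} \<notin> C\<close> by auto
      ultimately show False
        using no_cross cd chords_cross_iff_interleaved assms(2) \<open>y < n\<close> by blast
    qed
    then show "uncrossed C x y" unfolding uncrossed_def by blast
  next
    assume uncrossed: "uncrossed C x y"
    show "\<forall>f\<in>C. \<not> chords_cross n {x, y} f"
    proof
      fix f assume f: "f \<in> C"
      then obtain c d where cd: "f = {c, d}" "c < d" "d < n" using assms(1) ecb_edgesE by blast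
      then have "{x, y} \<noteq> {c, d}" "\<not> interleaved x y c d"
        using f \<open>{x, y} \<notin> C\<close> uncrossed unfolding uncrossed_def by auto
      then show "\<not> chords_cross n {x, y} f"
        using chords_cross_iff_interleaved[of x y n c d] cd assms(2) \<open>y < n\<close> by simp
    qed
  qed
  then show ?thesis using assms by (auto simp: legalC_def pair_in_ecb_edges_iff)
qed

definition legal_position :: "nat \<Rightarrow> nat set set \<Rightarrow> nat set set \<Rightarrow> bool" where
  "legal_position n C B \<longleftrightarrow> C \<subseteq> ecb_edges n \<and> noncrossing C \<and> C \<inter> B = {}"

definition unclaimed :: "nat \<Rightarrow> nat set set \<Rightarrow> nat set set \<Rightarrow> nat set set" where
  "unclaimed n C B = ecb_edges n - C - B"

lemma finite_unclaimed [simp]: "finite (unclaimed n C B)"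
  by (simp add: unclaimed_def)

lemma legalC_subset_unclaimed: "legalC n C B \<subseteq> unclaimed n C B"
  by (auto simp: legalC_def unclaimed_def)

lemma finite_legalC [simp]: "finite (legalC n C B)"
  using legalC_subset_unclaimed finite_unclaimed by (rule finite_subset)

lemma legal_position_insert_Constructor:
  assumes "legal_position n C B" "e \<in> legalC n C B"
  shows "legal_position n (insert e C) B"
proof -
  have e: "e \<in> ecb_edges n" "e \<notin> B" using assms(2) by (auto simp: legalC_def)
  then obtain x y where xy: "e = {x, y}" "x < y" by (auto elim: ecb_edgesE)
  then have "uncrossed C x y"
    using assms pair_in_legalC_iff[of C n x y B] by (simp add: legal_position_def)
  then show ?thesis
    using assms(1) e xy noncrossing_insert[of C x y] by (simp add: legal_position_def)
qed

lemma legal_position_insert_Blocker: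
  "legal_position n C B \<Longrightarrow> f \<in> unclaimed n C B \<Longrightarrow> legal_position n C (insert f B)"
  by (auto simp: legal_position_def unclaimed_def)

definition ecb_value :: "nat \<Rightarrow> bool \<Rightarrow> nat set set \<Rightarrow> nat set set \<Rightarrow> nat" where
  "ecb_value n t C B = ecb_val n (card (unclaimed n C B)) t C B"

lemma g_ECB_K3_eq: "g_ECB_K3 n = ecb_value n True {} {}"
  by (simp add: g_ECB_K3_def ecb_value_def unclaimed_def)

lemma card_unclaimed_insert:
  assumes "e \<in> unclaimed n C B"
  shows "card (unclaimed n C B) = Suc (card (unclaimed n (insert e C) B))"
    and "card (unclaimed n C B) = Suc (card (unclaimed n C (insert e B)))"
proof -
  have "unclaimed n (insert e C) B = unclaimed n C B - {e}"
    "unclaimed n C (insert e B) = unclaimed n C B - {e}"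
    by (auto simp: unclaimed_def)
  then show "card (unclaimed n C B) = Suc (card (unclaimed n (insert e C) B))"
    "card (unclaimed n C B) = Suc (card (unclaimed n C (insert e B)))"
    using card.remove[OF finite_unclaimed assms] by simp_all
qed

lemma ecb_value_terminal:
  assumes "legalC n C B = {}" shows "ecb_value n t C B = triangles n C"
  unfolding ecb_value_def using assms by (cases "card (unclaimed n C B)"; cases t) auto

lemma ecb_value_Constructor:
  assumes "legalC n C B \<noteq> {}"
  shows "ecb_value n True C B = (MAX e\<in>legalC n C B. ecb_value n False (insert e C) B)"
proof -
  obtain k where k: "card (unclaimed n C B) = Suc k"
    using assms legalC_subset_unclaimed card_unclaimed_insert(1) by blast
  have "card (unclaimed n (insert e C) B) = k" if "e \<in> legalC n C B" for e
    using card_unclaimed_insert(1)[of e n C B] legalC_subset_unclaimed that k by auto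
  then show ?thesis using assms by (simp add: ecb_value_def k cong: image_cong)
qed

lemma ecb_value_Blocker:
  assumes "legalC n C B \<noteq> {}"
  shows "ecb_value n False C B = (MIN f\<in>unclaimed n C B. ecb_value n True C (insert f B))"
proof -
  have ne: "unclaimed n C B \<noteq> {}" using assms legalC_subset_unclaimed by blast
  then obtain k where k: "card (unclaimed n C B) = Suc k" using card_unclaimed_insert(2) by blast
  have "card (unclaimed n C (insert f B)) = k" if "f \<in> unclaimed n C B" for f
    using card_unclaimed_insert(2)[OF that] k by simp
  then show ?thesis
    using assms ne by (simp add: ecb_value_def k flip: unclaimed_def cong: image_cong)
qed

lemma ecb_value_le_by_Blocker_strategy:
  assumes "I t C B"
    and terminal: "\<And>t C B. I t C B \<Longrightarrow> legalC n C B = {} \<Longrightarrow> triangles n C \<le> v"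
    and Constructor: "\<And>C B e. I True C B \<Longrightarrow> e \<in> legalC n C B \<Longrightarrow> I False (insert e C) B"
    and Blocker: "\<And>C B. I False C B \<Longrightarrow> legalC n C B \<noteq> {} \<Longrightarrow>
      \<exists>f\<in>unclaimed n C B. I True C (insert f B)"
  shows "ecb_value n t C B \<le> v"
  using assms(1)
proof (induction "card (unclaimed n C B)" arbitrary: t C B rule: less_induct)
  case less
  show ?case
  proof (cases "legalC n C B = {}")
    case True
    then show ?thesis using terminal[OF less.prems] by (simp add: ecb_value_terminal)
  next
    case legal: False
    show ?thesis
    proof (cases t)
      case True
      have "ecb_value n False (insert e C) B \<le> v" if e: "e \<in> legalC n C B" for e
      proof (rule less.hyps)
        show "card (unclaimed n (insert e C) B) < card (unclaimed n C B)"
          using card_unclaimed_insert(1) legalC_subset_unclaimed e by fastforce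
        show "I False (insert e C) B" using Constructor less.prems True e by simp
      qed
      then show ?thesis using legal by (simp add: True ecb_value_Constructor)
    next
      case False
      then obtain f where f: "f \<in> unclaimed n C B" "I True C (insert f B)"
        using Blocker less.prems legal by auto
      then have "ecb_value n True C (insert f B) \<le> v"
        by (intro less.hyps) (auto simp: card_unclaimed_insert(2))
      moreover have "ecb_value n False C B \<le> ecb_value n True C (insert f B)"
        unfolding ecb_value_Blocker[OF legal] using f(1) by (intro Min_le) auto
      ultimately show ?thesis using False by simp
    qed
  qed
qed

lemma ecb_value_ge_by_Constructor_strategy:
  assumes "I t C B"
    and terminal: "\<And>t C B. I t C B \<Longrightarrow> legalC n C B = {} \<Longrightarrow> v \<le> triangles n C"
    and Constructor: "\<And>C B. I True C B \<Longrightarrow> legalC n C B \<noteq> {} \<Longrightarrow>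
      \<exists>e\<in>legalC n C B. I False (insert e C) B"
    and Blocker: "\<And>C B f. I False C B \<Longrightarrow> f \<in> unclaimed n C B \<Longrightarrow> I True C (insert f B)"
  shows "v \<le> ecb_value n t C B"
  using assms(1)
proof (induction "card (unclaimed n C B)" arbitrary: t C B rule: less_induct)
  case less
  show ?case
  proof (cases "legalC n C B = {}")
    case True
    then show ?thesis using terminal[OF less.prems] by (simp add: ecb_value_terminal)
  next
    case legal: False
    show ?thesis
    proof (cases t)
      case True
      then obtain e where e: "e \<in> legalC n C B" "I False (insert e C) B"
        using Constructor less.prems legal by auto
      then have "v \<le> ecb_value n False (insert e C) B"
        using card_unclaimed_insert(1) legalC_subset_unclaimed by (intro less.hyps) fastforce+
      also have "\<dots> \<le> ecb_value n True C B"
        unfolding ecb_value_Constructor[OF legal] using e(1) by (intro Max_ge) auto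
      finally show ?thesis using True by simp
    next
      case False
      have "v \<le> ecb_value n True C (insert f B)" if f: "f \<in> unclaimed n C B" for f
        using Blocker less.prems False f
        by (intro less.hyps) (auto simp: card_unclaimed_insert(2))
      moreover have "unclaimed n C B \<noteq> {}" using legal legalC_subset_unclaimed by blast
      ultimately show ?thesis using False by (simp add: ecb_value_Blocker[OF legal])
    qed
  qed
qed

section \<open>Blocker takes a third of the sides\<close>

abbreviation side :: "nat \<Rightarrow> nat set" where
  "side b \<equiv> {b, Suc b}"

lemma side_eq_iff: "side a = side b \<longleftrightarrow> a = b"
  by (auto simp: doubleton_eq_iff)

lemma side_in_unclaimed_iff: "side b \<in> unclaimed n C B \<longleftrightarrow> Suc b < n \<and> side b \<notin> C \<and> side b \<notin> B"
  by (auto simp: unclaimed_def pair_in_ecb_edges_iff)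

lemma side_in_legalC:
  assumes "legal_position n C B" "side b \<in> unclaimed n C B"
  shows "side b \<in> legalC n C B"
proof -
  have "uncrossed C b (Suc b)" by (auto simp: uncrossed_def interleaved_def)
  then show ?thesis
    using assms by (simp add: pair_in_legalC_iff legal_position_def side_in_unclaimed_iff)
qed

lemma not_both_middle:
  assumes "noncrossing C" "side b \<notin> C" "middle C b"
  shows "\<not> middle C (Suc b)"
proof
  assume "middle C (Suc b)"
  then obtain a where a: "a < Suc b" "{a, Suc b} \<in> C" by (auto simp: middle_def triangle_def)
  obtain c where c: "b < c" "{b, c} \<in> C" using assms(3) by (auto simp: middle_def triangle_def)
  have "a \<noteq> b" "c \<noteq> Suc b" using a c assms(2) by auto
  then have "interleaved a (Suc b) b c" using a(1) c(1) by (auto simp: interleaved_def)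
  then show False using noncrossingD[OF assms(1) a(2) c(2)] by blast
qed

definition disjoint_sides :: "nat \<Rightarrow> nat set set \<Rightarrow> nat set \<Rightarrow> bool" where
  "disjoint_sides n B P \<longleftrightarrow> (\<forall>b\<in>P. Suc b < n \<and> side b \<in> B \<and> Suc b \<notin> P)"

lemma triangles_plus_disjoint_sides:
  assumes "legal_position n C B" "disjoint_sides n B P"
  shows "triangles n C + card P \<le> n"
proof -
  have C: "C \<subseteq> ecb_edges n" "noncrossing C" "C \<inter> B = {}"
    using assms(1) by (auto simp: legal_position_def)
  define M where "M = {b. middle C b}"
  have M: "M \<subseteq> {..<n}" using middle_less[OF C(1)] by (auto simp: M_def)
  define nonmiddle_end where "nonmiddle_end b = (if b \<in> M then Suc b else b)" for b
  have "nonmiddle_end ` P \<subseteq> {..<n} - M"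
  proof clarify
    fix b assume "b \<in> P"
    then have "side b \<notin> C" "Suc b < n" using assms(2) C(3) by (auto simp: disjoint_sides_def)
    then show "nonmiddle_end b \<in> {..<n} - M"
      using not_both_middle[OF C(2), of b] by (auto simp: nonmiddle_end_def M_def)
  qed
  moreover have "inj_on nonmiddle_end P"
    using assms(2) by (auto simp: inj_on_def nonmiddle_end_def disjoint_sides_def split: if_splits)
  ultimately have "card P \<le> card ({..<n} - M)" by (intro card_inj_on_le) auto
  also have "\<dots> = n - card M" using M by (simp add: card_Diff_subset finite_subset)
  finally have "card P \<le> n - card M" .
  moreover have "card M \<le> n" using M by (metis card_lessThan card_mono finite_lessThan)
  ultimately show ?thesis using triangles_eq_card_middle[OF C(1,2)] by (simp add: M_def)
qed

definition sides_secured :: "nat \<Rightarrow> nat set set \<Rightarrow> nat set set \<Rightarrow> bool" where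
  "sides_secured n C B \<longleftrightarrow>
     legal_position n C B \<and> (\<exists>P. disjoint_sides n B P \<and> n \<le> 3 * card P + 2)"

lemma sides_secured_triangles:
  assumes "sides_secured n C B" shows "3 * triangles n C \<le> 2 * n + 2"
proof -
  obtain P where P: "disjoint_sides n B P" "n \<le> 3 * card P + 2"
    using assms by (auto simp: sides_secured_def)
  moreover have "triangles n C + card P \<le> n"
    using triangles_plus_disjoint_sides[OF _ P(1)] assms by (simp add: sides_secured_def)
  ultimately show ?thesis by linarith
qed

lemma sides_secured_insert_Constructor:
  "sides_secured n C B \<Longrightarrow> e \<in> legalC n C B \<Longrightarrow> sides_secured n (insert e C) B"
  using legal_position_insert_Constructor by (auto simp: sides_secured_def)

lemma sides_secured_insert_Blocker:
  assumes "sides_secured n C B" "f \<in> unclaimed n C B"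
  shows "sides_secured n C (insert f B)"
proof -
  obtain P where "disjoint_sides n B P" "n \<le> 3 * card P + 2"
    using assms(1) by (auto simp: sides_secured_def)
  moreover from this have "disjoint_sides n (insert f B) P" by (auto simp: disjoint_sides_def)
  ultimately show ?thesis
    using assms legal_position_insert_Blocker by (auto simp: sides_secured_def)
qed

definition sides_from :: "nat \<Rightarrow> nat set set \<Rightarrow> nat set" where
  "sides_from j C = {b. j \<le> b \<and> side b \<in> C}"

lemma finite_sides_from: "C \<subseteq> ecb_edges n \<Longrightarrow> finite (sides_from j C)"
  by (rule finite_subset[of _ "{..<n}"]) (auto simp: sides_from_def pair_in_ecb_edges_iff)

lemma card_sides_from_insert:
  assumes "finite (sides_from j C)"
  shows "card (sides_from j (insert e C)) \<le> Suc (card (sides_from j C))"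
proof (cases "\<exists>b. e = side b")
  case True
  then obtain b where "e = side b" by blast
  then have "sides_from j (insert e C) \<subseteq> insert b (sides_from j C)"
    by (auto simp: sides_from_def side_eq_iff)
  then have "card (sides_from j (insert e C)) \<le> card (insert b (sides_from j C))"
    using assms by (intro card_mono) auto
  then show ?thesis using assms by (simp add: card_insert_if split: if_splits)
next
  case False
  then have "sides_from j (insert e C) = sides_from j C" by (auto simp: sides_from_def)
  then show ?thesis by simp
qed

text \<open>The sides below \<open>j\<close> are settled, those indexed by \<open>P\<close> in Blocker's favour, and Constructor's
  sides at or above \<open>j\<close> are charged in advance. The slack \<open>s\<close> is \<open>0\<close> when Constructor is to move
  and \<open>1\<close> when Blocker is to move.\<close>
definition sweep :: "nat \<Rightarrow> nat \<Rightarrow> nat \<Rightarrow> nat set \<Rightarrow> nat set set \<Rightarrow> nat set set \<Rightarrow> bool" where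
  "sweep n s j P C B \<longleftrightarrow> legal_position n C B \<and> disjoint_sides n B P \<and>
     (\<forall>b\<in>P. Suc b < j) \<and> (\<forall>b\<ge>j. side b \<notin> B) \<and> j + card (sides_from j C) \<le> 3 * card P + s"

lemma sweep_exhausted:
  assumes "sweep n s j P C B" "s \<le> 1" and all: "\<And>b. j \<le> b \<Longrightarrow> Suc b < n \<Longrightarrow> side b \<in> C"
  shows "sides_secured n C B"
proof -
  have "C \<subseteq> ecb_edges n" using assms(1) by (simp add: sweep_def legal_position_def)
  then have "card {j..<n - 1} \<le> card (sides_from j C)"
    by (intro card_mono finite_sides_from) (use all in \<open>auto simp: sides_from_def\<close>)
  then have "n \<le> 3 * card P + 2"
    using assms(1,2) unfolding sweep_def card_atLeastLessThan by linarith
  then show ?thesis using assms(1) unfolding sweep_def sides_secured_def by blast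
qed

lemma sweep_terminal:
  assumes "sweep n s j P C B" "s \<le> 1" "legalC n C B = {}"
  shows "sides_secured n C B"
proof (rule sweep_exhausted[OF assms(1,2)])
  fix b assume "j \<le> b" "Suc b < n"
  then have "side b \<in> unclaimed n C B" if "side b \<notin> C"
    using assms(1) that by (auto simp: side_in_unclaimed_iff sweep_def)
  then show "side b \<in> C" using side_in_legalC assms(1,3) unfolding sweep_def by blast
qed

lemma sweep_insert_Constructor:
  assumes "sweep n 0 j P C B" "e \<in> legalC n C B"
  shows "sweep n 1 j P (insert e C) B"
proof -
  have "finite (sides_from j C)"
    using assms(1) finite_sides_from unfolding sweep_def legal_position_def by blast
  moreover have "e \<notin> B" using assms(2) by (auto simp: legalC_def)
  ultimately show ?thesis
    using assms legal_position_insert_Constructor card_sides_from_insert[of j C e]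
    unfolding sweep_def by auto
qed

lemma sweep_insert_side:
  assumes sweep: "sweep n 1 j P C B" and b: "j \<le> b" "side b \<in> unclaimed n C B"
    and below: "\<And>i. j \<le> i \<Longrightarrow> i < b \<Longrightarrow> side i \<in> C"
  shows "sweep n 0 (b + 2) (insert b P) C (insert (side b) B)"
proof -
  have C: "C \<subseteq> ecb_edges n" and P: "\<And>i. i \<in> P \<Longrightarrow> Suc i < j"
    using sweep by (auto simp: sweep_def legal_position_def)
  have "finite P" by (rule finite_subset[of _ "{..<j}"]) (use P in force)+
  moreover have "b \<notin> P" using P b(1) by force
  ultimately have "card (insert b P) = Suc (card P)" by simp
  moreover have "card ({j..<b} \<union> sides_from (b + 2) C) \<le> card (sides_from j C)"
    by (intro card_mono finite_sides_from[OF C]) (use b below in \<open>auto simp: sides_from_def\<close>)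
  moreover have "card ({j..<b} \<union> sides_from (b + 2) C) = b - j + card (sides_from (b + 2) C)"
    by (subst card_Un_disjoint) (auto simp: finite_sides_from[OF C], auto simp: sides_from_def)
  ultimately have "b + 2 + card (sides_from (b + 2) C) \<le> 3 * card (insert b P)"
    using sweep b(1) unfolding sweep_def by linarith
  moreover have "disjoint_sides n (insert (side b) B) (insert b P)"
    using sweep b P unfolding sweep_def disjoint_sides_def side_in_unclaimed_iff by fastforce
  moreover have "\<forall>i\<in>insert b P. Suc i < b + 2" using P b(1) by fastforce
  moreover have "\<forall>i\<ge>b + 2. side i \<notin> insert (side b) B"
    using sweep b(1) unfolding sweep_def by (auto simp: side_eq_iff)
  ultimately show ?thesis
    using sweep b(2) legal_position_insert_Blocker unfolding sweep_def by simp
qed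

lemma sweep_Blocker_reply:
  assumes "sweep n 1 j P C B" "\<not> sides_secured n C B"
  shows "\<exists>b j' P'. side b \<in> unclaimed n C B \<and> sweep n 0 j' P' C (insert (side b) B)"
proof -
  let ?open = "\<lambda>b. j \<le> b \<and> Suc b < n \<and> side b \<notin> C"
  have "\<exists>b. ?open b" using sweep_exhausted[OF assms(1)] assms(2) by auto
  from exists_least_iff[THEN iffD1, OF this]
  obtain b where b: "?open b" and below: "\<forall>i<b. \<not> ?open i" by blast
  have "side b \<in> unclaimed n C B" using assms(1) b by (auto simp: side_in_unclaimed_iff sweep_def)
  moreover from this have "sweep n 0 (b + 2) (insert b P) C (insert (side b) B)"
    using b below by (intro sweep_insert_side[OF assms(1)]) auto
  ultimately show ?thesis by blast
qed

definition Blocker_invariant :: "nat \<Rightarrow> bool \<Rightarrow> nat set set \<Rightarrow> nat set set \<Rightarrow> bool" where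
  "Blocker_invariant n t C B \<longleftrightarrow>
     sides_secured n C B \<or> (\<exists>j P. sweep n (if t then 0 else 1) j P C B)"

lemma g_ECB_K3_upper: "3 * g_ECB_K3 n \<le> 2 * n + 2"
proof -
  have "ecb_value n True {} {} \<le> (2 * n + 2) div 3"
  proof (rule ecb_value_le_by_Blocker_strategy[of "Blocker_invariant n"])
    have "sweep n 0 0 {} {} {}"
      by (simp add: sweep_def legal_position_def noncrossing_def disjoint_sides_def sides_from_def)
    then show "Blocker_invariant n True {} {}" by (auto simp: Blocker_invariant_def)
  next
    fix t C B assume "Blocker_invariant n t C B" "legalC n C B = {}"
    then have "sides_secured n C B"
      using sweep_terminal unfolding Blocker_invariant_def by (auto split: if_splits)
    then show "triangles n C \<le> (2 * n + 2) div 3" using sides_secured_triangles by fastforce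
  next
    fix C B e assume "Blocker_invariant n True C B" "e \<in> legalC n C B"
    then show "Blocker_invariant n False (insert e C) B"
      using sides_secured_insert_Constructor sweep_insert_Constructor
      unfolding Blocker_invariant_def by (simp only: if_True if_False) blast
  next
    fix C B assume inv: "Blocker_invariant n False C B" and "legalC n C B \<noteq> {}"
    then obtain f where f: "f \<in> unclaimed n C B" using legalC_subset_unclaimed by blast
    show "\<exists>f\<in>unclaimed n C B. Blocker_invariant n True C (insert f B)"
    proof (cases "sides_secured n C B")
      case True
      then show ?thesis
        using f sides_secured_insert_Blocker unfolding Blocker_invariant_def by blast
    next
      case False
      then show ?thesis
        using inv sweep_Blocker_reply unfolding Blocker_invariant_def
        by (simp only: if_True if_False) blast
    qed
  qed
  then show ?thesis unfolding g_ECB_K3_eq by linarith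
qed

section \<open>Constructor's polygon\<close>

definition consecutive :: "'a::linorder set \<Rightarrow> 'a \<Rightarrow> 'a \<Rightarrow> bool" where
  "consecutive S l r \<longleftrightarrow> l \<in> S \<and> r \<in> S \<and> l < r \<and> (\<forall>x\<in>S. \<not> (l < x \<and> x < r))"

definition gaps :: "'a::linorder set \<Rightarrow> 'a set set \<Rightarrow> 'a set" where
  "gaps S C = {l. \<exists>r. consecutive S l r \<and> {l, r} \<notin> C}"

definition diagonal :: "'a::linorder set \<Rightarrow> 'a \<Rightarrow> 'a \<Rightarrow> bool" where
  "diagonal S a b \<longleftrightarrow>
     a \<in> S \<and> b \<in> S \<and> (\<exists>x\<in>S. a < x \<and> x < b) \<and> (\<exists>x\<in>S. x < a \<or> b < x)"

lemma consecutive_unique: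
  "consecutive S l r \<Longrightarrow> consecutive S l r' \<Longrightarrow> r = r'"
  "consecutive S l r \<Longrightarrow> consecutive S l' r \<Longrightarrow> l = l'"
  unfolding consecutive_def by (metis linorder_neqE)+

lemma diagonal_less: "diagonal S a b \<Longrightarrow> a < b"
  by (auto simp: diagonal_def)

lemma diagonal_if_interleaved:
  "interleaved a b x y \<Longrightarrow> a \<in> S \<Longrightarrow> b \<in> S \<Longrightarrow> x \<in> S \<Longrightarrow> y \<in> S \<Longrightarrow> diagonal S x y"
  unfolding diagonal_def interleaved_def by (auto dest: order.strict_trans)

lemma consecutive_neq_diagonal: "consecutive S l r \<Longrightarrow> diagonal S a b \<Longrightarrow> {l, r} \<noteq> {a, b}"
  unfolding consecutive_def diagonal_def by (auto simp: doubleton_eq_iff)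

lemma gaps_subset: "gaps S C \<subseteq> S"
  by (auto simp: gaps_def consecutive_def)

lemma gaps_insert_diagonal: "diagonal S x y \<Longrightarrow> gaps S (insert {x, y} C) = gaps S C"
  unfolding gaps_def using consecutive_neq_diagonal by blast

lemma gaps_insert_consecutive:
  assumes "consecutive S l r"
  shows "gaps S (insert {l, r} C) = gaps S C - {l}"
proof -
  have "{l', r'} = {l, r} \<longleftrightarrow> l' = l" if "consecutive S l' r'" for l' r'
    using consecutive_unique(1)[OF assms] that assms unfolding consecutive_def doubleton_eq_iff
    by (metis order.asym)
  then show ?thesis unfolding gaps_def by auto
qed

text \<open>Constructor's edges live on the polygon \<open>S\<close> with extreme vertices \<open>0\<close> and \<open>m\<close>. A side
  missing from her graph is a gap; its ends have a common lower neighbour. Blocker owns no diagonal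
  that could still be used to triangulate \<open>S\<close>.\<close>
locale polygon =
  fixes n m :: nat and S :: "nat set" and C B :: "nat set set"
  assumes zero_in_S: "0 \<in> S" and m_in_S: "m \<in> S" and S_le_m: "x \<in> S \<Longrightarrow> x \<le> m"
    and m_pos: "0 < m" and m_less_n: "m < n"
    and C_inside: "e \<in> C \<Longrightarrow> \<exists>a\<in>S. \<exists>b\<in>S. a \<noteq> b \<and> e = {a, b}"
    and noncrossing_C: "noncrossing C" and C_B_disjoint: "C \<inter> B = {}"
    and spanned: "consecutive S l r \<Longrightarrow> {l, r} \<in> C \<or> (\<exists>p<l. {p, l} \<in> C \<and> {p, r} \<in> C)"
    and uncrossed_diagonal_free: "diagonal S a b \<Longrightarrow> uncrossed C a b \<Longrightarrow> {a, b} \<notin> B"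
begin

lemma S_less_n: "x \<in> S \<Longrightarrow> x < n"
  using S_le_m m_less_n by fastforce

lemma finite_S: "finite S"
  by (rule finite_subset[of _ "{..<n}"]) (auto simp: S_less_n)

lemma finite_gaps: "finite (gaps S C)"
  using gaps_subset finite_S by (rule finite_subset)

lemma edgeD: "{a, b} \<in> C \<Longrightarrow> a \<in> S \<and> b \<in> S \<and> a \<noteq> b"
  using C_inside[of "{a, b}"] by (auto simp: doubleton_eq_iff)

lemma edge_above_m_notin_C: "m < z \<Longrightarrow> {x, z} \<notin> C"
  using edgeD S_le_m by fastforce

lemma C_subset_edges: "C \<subseteq> ecb_edges n"
  using C_inside S_less_n by (force simp: pair_in_ecb_edges_iff)

lemma finite_neighbours: "finite {w. {a, w} \<in> C}"
  by (rule finite_subset[OF _ finite_S]) (use edgeD in blast)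

lemma successor_exists:
  assumes "b \<in> S" "b < m" obtains r where "consecutive S b r"
proof -
  have "\<exists>r. r \<in> S \<and> b < r" using assms m_in_S by blast
  from exists_least_iff[THEN iffD1, OF this]
  obtain r where "r \<in> S" "b < r" "\<And>x. x < r \<Longrightarrow> \<not> (x \<in> S \<and> b < x)" by blast
  then show ?thesis using that assms(1) unfolding consecutive_def by blast
qed

lemma predecessor_exists:
  assumes "b \<in> S" "0 < b" obtains l where "consecutive S l b"
proof -
  have "finite {x\<in>S. x < b}" "{x\<in>S. x < b} \<noteq> {}" using finite_S assms zero_in_S by auto
  from finite_has_maximal[OF this]
  obtain l where l: "l \<in> S" "l < b" and maximal: "\<forall>x\<in>{x\<in>S. x < b}. l \<le> x \<longrightarrow> l = x" by auto
  then have "\<not> (l < x \<and> x < b)" if "x \<in> S" for x using that by auto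
  then show ?thesis using that l assms(1) unfolding consecutive_def by blast
qed

lemma lowest_neighbour:
  assumes "b \<in> S" "0 < b"
  obtains p where "p < b" "{p, b} \<in> C" "\<And>w. w < p \<Longrightarrow> {w, b} \<notin> C"
proof -
  obtain l where l: "consecutive S l b" using predecessor_exists assms by blast
  then have "\<exists>p. p < b \<and> {p, b} \<in> C"
    using spanned[OF l] by (auto simp: consecutive_def intro: order.strict_trans)
  from exists_least_iff[THEN iffD1, OF this]
  obtain p where "p < b" "{p, b} \<in> C" "\<And>w. w < p \<Longrightarrow> \<not> (w < b \<and> {w, b} \<in> C)" by blast
  then show ?thesis by (intro that[of p]) (auto dest: order.strict_trans)
qed

lemma highest_neighbour:
  assumes "{b, w} \<in> C" "b < w"
  obtains q where "b < q" "{b, q} \<in> C" "\<And>w. q < w \<Longrightarrow> {b, w} \<notin> C"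
proof -
  have "{w. {b, w} \<in> C} \<noteq> {}" using assms by auto
  from finite_has_maximal[OF finite_neighbours this]
  obtain q where q: "{b, q} \<in> C" and maximal: "\<And>w. {b, w} \<in> C \<Longrightarrow> w \<le> q"
    by (metis linorder_linear mem_Collect_eq)
  then show ?thesis using that[of q] assms maximal[of w] by (meson leD order.strict_trans2)
qed

lemma crossing_pair_from_0:
  assumes "b \<in> S" "0 < b" "b < m" "{0, b} \<notin> C" "uncrossed C 0 b"
  shows "\<exists>x y. x \<in> S \<and> y \<in> S \<and> uncrossed C x y \<and> interleaved 0 b x y"
proof -
  obtain p where p: "p < b" "{p, b} \<in> C" "\<And>w. w < p \<Longrightarrow> {w, b} \<notin> C"
    using lowest_neighbour assms(1,2) by blast
  then have "0 < p" using assms(4) by (cases "p = 0") auto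
  obtain r where r: "consecutive S b r" using successor_exists assms(1,3) by blast
  then have "b < r" by (simp add: consecutive_def)
  have "{b, r} \<in> C"
  proof (rule ccontr)
    assume "{b, r} \<notin> C"
    then obtain p' where p': "p' < b" "{p', b} \<in> C" "{p', r} \<in> C" using spanned[OF r] by blast
    then have "interleaved 0 b p' r"
      using assms(4) \<open>b < r\<close> by (cases "p' = 0") (auto simp: interleaved_def)
    then show False using assms(5) p'(3) unfolding uncrossed_def by blast
  qed
  then obtain q where q: "b < q" "{b, q} \<in> C" "\<And>w. q < w \<Longrightarrow> {b, w} \<notin> C"
    using highest_neighbour \<open>b < r\<close> by blast
  have "uncrossed C p q"
    using p q by (intro uncrossed_extreme_neighbours[OF noncrossing_C, of p b]) auto
  moreover have "interleaved 0 b p q" using p q \<open>0 < p\<close> by (simp add: interleaved_def)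
  ultimately show ?thesis using p q edgeD by blast
qed

lemma crossing_pair_from_positive:
  assumes "a \<in> S" "0 < a" "x \<in> S" "a < x" "x < b" "{a, b} \<notin> C" "uncrossed C a b"
  shows "\<exists>x y. x \<in> S \<and> y \<in> S \<and> uncrossed C x y \<and> interleaved a b x y"
proof -
  obtain p where p: "p < a" "{p, a} \<in> C" using lowest_neighbour assms(1,2) by blast
  have "a < m" using assms(3,4) S_le_m by fastforce
  then obtain r where r: "consecutive S a r" using successor_exists assms(1) by blast
  then have "a < r" "r < b" using assms(3-5) by (auto simp: consecutive_def not_less)
  have "{a, r} \<in> C"
  proof (rule ccontr)
    assume "{a, r} \<notin> C"
    then obtain p' where "p' < a" "{p', r} \<in> C" using spanned[OF r] by blast
    then show False
      using assms(7) \<open>a < r\<close> \<open>r < b\<close> unfolding uncrossed_def interleaved_def by blast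
  qed
  moreover have "{a, p} \<in> C" using p(2) by (simp add: insert_commute)
  ultimately obtain x y where "{a, x} \<in> C" "{a, y} \<in> C" "uncrossed C x y" "interleaved a b x y"
    using uncrossed_pair_crossing_at_vertex[OF noncrossing_C finite_neighbours assms(6)]
      \<open>a < r\<close> \<open>r < b\<close> p(1) by blast
  then show ?thesis using edgeD by blast
qed

lemma crossing_diagonal:
  assumes "diagonal S a b" "uncrossed C a b" "{a, b} \<notin> C"
  obtains x y where "diagonal S x y" "uncrossed C x y" "interleaved a b x y"
proof -
  obtain w w' where S: "a \<in> S" "b \<in> S" "w \<in> S" "a < w" "w < b" "w' \<in> S" "w' < a \<or> b < w'"
    using assms(1) by (auto simp: diagonal_def)
  have "\<exists>x y. x \<in> S \<and> y \<in> S \<and> uncrossed C x y \<and> interleaved a b x y"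
  proof (cases "a = 0")
    case True
    then have "b < m" using S_le_m[OF S(6)] S(7) by simp
    then show ?thesis using crossing_pair_from_0[OF S(2)] S(4,5) assms(2,3) True by simp
  next
    case False
    then show ?thesis
      using crossing_pair_from_positive[OF S(1) _ S(3-5)] assms(2,3) by simp
  qed
  then show ?thesis using that diagonal_if_interleaved S(1,2) by blast
qed

lemma insert_Constructor:
  assumes "x \<in> S" "y \<in> S" "x < y" "uncrossed C x y" "{x, y} \<notin> B"
  shows "polygon n m S (insert {x, y} C) B"
proof
  show "noncrossing (insert {x, y} C)" using noncrossing_insert[OF noncrossing_C] assms by blast
  show "\<exists>a\<in>S. \<exists>b\<in>S. a \<noteq> b \<and> e = {a, b}" if "e \<in> insert {x, y} C" for e
    using that C_inside assms by (metis insertE nat_neq_iff)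
  show "{a, b} \<notin> B" if "diagonal S a b" "uncrossed (insert {x, y} C) a b" for a b
    using uncrossed_diagonal_free that uncrossed_antimono by blast
  show "insert {x, y} C \<inter> B = {}" using C_B_disjoint assms(5) by simp
  show "{l, r} \<in> insert {x, y} C \<or> (\<exists>p<l. {p, l} \<in> insert {x, y} C \<and> {p, r} \<in> insert {x, y} C)"
    if "consecutive S l r" for l r
    using spanned[OF that] by blast
qed (fact zero_in_S m_in_S S_le_m m_pos m_less_n)+

lemma insert_Blocker:
  assumes "{u, v} \<notin> C" "u < v" "diagonal S u v \<Longrightarrow> \<not> uncrossed C u v"
  shows "polygon n m S C (insert {u, v} B)"
proof
  show "C \<inter> insert {u, v} B = {}" using C_B_disjoint assms(1) by simp
  show "{a, b} \<notin> insert {u, v} B" if ab: "diagonal S a b" "uncrossed C a b" for a b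
  proof -
    have "{a, b} \<noteq> {u, v}"
      using ab assms(2,3) diagonal_less[OF ab(1)] by (auto simp: doubleton_eq_iff)
    then show ?thesis using uncrossed_diagonal_free[OF ab] by simp
  qed
qed (fact zero_in_S m_in_S S_le_m m_pos m_less_n C_inside noncrossing_C spanned)+

lemma consecutive_insert_top:
  assumes "m < z"
  shows "consecutive (insert z S) l r \<longleftrightarrow> consecutive S l r \<or> l = m \<and> r = z"
proof
  assume adjacent: "consecutive (insert z S) l r"
  have "l \<noteq> z" using adjacent S_le_m assms unfolding consecutive_def by fastforce
  then have "l \<in> S" using adjacent by (auto simp: consecutive_def)
  show "consecutive S l r \<or> l = m \<and> r = z"
  proof (cases "r = z")
    case True
    then have "\<not> l < m" using adjacent m_in_S assms unfolding consecutive_def by blast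
    then show ?thesis using S_le_m[OF \<open>l \<in> S\<close>] True by auto
  qed (use adjacent \<open>l \<in> S\<close> in \<open>auto simp: consecutive_def\<close>)
next
  assume "consecutive S l r \<or> l = m \<and> r = z"
  then show "consecutive (insert z S) l r"
    using S_le_m m_in_S assms unfolding consecutive_def by force
qed

lemma diagonal_insert_top:
  assumes "m < z" "diagonal (insert z S) a b"
  shows "diagonal S a b \<or> b = z \<or> a = 0 \<and> b = m"
proof (cases "b = z")
  case False
  obtain x where x: "x \<in> insert z S" "a < x" "x < b" and b: "b \<in> S"
    using assms(2) False by (auto simp: diagonal_def)
  then have "x \<in> S" "a \<in> S" using S_le_m[OF b] assms by (auto simp: diagonal_def)
  show ?thesis
  proof (cases "\<exists>w\<in>S. w < a \<or> b < w")
    case True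
    then show ?thesis using x b \<open>x \<in> S\<close> \<open>a \<in> S\<close> by (auto simp: diagonal_def)
  next
    case False
    then have "a = 0" "b = m" using zero_in_S m_in_S S_le_m[OF b] by force+
    then show ?thesis by simp
  qed
qed simp

lemma insert_top:
  assumes z: "m < z" "z < n" "\<And>x. x \<in> S \<Longrightarrow> {x, z} \<notin> B"
    and q: "q \<in> S" "uncrossed C q z" "q = m \<or> {q, m} \<in> C"
    and base: "uncrossed (insert {q, z} C) 0 m \<Longrightarrow> {0, m} \<notin> B"
  shows "polygon n z (insert z S) (insert {q, z} C) B"
proof
  have "q \<le> m" using q(1) by (rule S_le_m)
  then have "q < z" using z(1) by simp
  show "noncrossing (insert {q, z} C)"
    using noncrossing_C \<open>q < z\<close> q(2) by (rule noncrossing_insert)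
  show "\<exists>a\<in>insert z S. \<exists>b\<in>insert z S. a \<noteq> b \<and> e = {a, b}" if "e \<in> insert {q, z} C" for e
  proof (cases "e = {q, z}")
    case True
    then show ?thesis using q(1) \<open>q < z\<close> by (intro bexI[of _ q] bexI[of _ z]) auto
  qed (use that C_inside in blast)
  show "insert {q, z} C \<inter> B = {}" using C_B_disjoint z(3)[OF q(1)] by auto
  show "{l, r} \<in> insert {q, z} C \<or> (\<exists>p<l. {p, l} \<in> insert {q, z} C \<and> {p, r} \<in> insert {q, z} C)"
    if "consecutive (insert z S) l r" for l r
    using that unfolding consecutive_insert_top[OF z(1)]
  proof
    assume "consecutive S l r" then show ?thesis using spanned by blast
  next
    assume "l = m \<and> r = z"
    moreover have "q < m \<and> {q, m} \<in> C" if "q \<noteq> m" using that q(3) \<open>q \<le> m\<close> by auto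
    ultimately show ?thesis by (cases "q = m") blast+
  qed
  show "{a, b} \<notin> B"
    if ab: "diagonal (insert z S) a b" "uncrossed (insert {q, z} C) a b" for a b
  proof -
    have "a < b" using ab(1) by (rule diagonal_less)
    then have "{a, b} \<notin> B" if "b = z"
      using that z(3)[of a] ab(1) by (auto simp: diagonal_def)
    then show ?thesis
      using diagonal_insert_top[OF z(1) ab(1)] uncrossed_diagonal_free base ab(2)
        uncrossed_antimono[OF ab(2)] by blast
  qed
  show "x \<le> z" if "x \<in> insert z S" for x using that S_le_m z(1) by fastforce
qed (use zero_in_S z m_pos in auto)

lemma m_notin_gaps: "m \<notin> gaps S C"
  using S_le_m by (force simp: gaps_def consecutive_def)

lemma consecutive_neq_new_edge: "m < z \<Longrightarrow> consecutive S l r \<Longrightarrow> {l, r} \<noteq> {q, z}"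
  using S_le_m unfolding consecutive_def doubleton_eq_iff by fastforce

lemma gaps_insert_top_side:
  assumes "m < z" shows "gaps (insert z S) (insert {m, z} C) = gaps S C"
  using consecutive_insert_top[OF assms] consecutive_neq_new_edge[OF assms]
  unfolding gaps_def by auto

lemma gaps_insert_top_fan:
  assumes "m < z" "q < m"
  shows "gaps (insert z S) (insert {q, z} C) = insert m (gaps S C)"
proof -
  have "{m, z} \<notin> insert {q, z} C"
    using edge_above_m_notin_C[OF assms(1)] assms by (auto simp: doubleton_eq_iff)
  then show ?thesis
    using consecutive_insert_top[OF assms(1)] consecutive_neq_new_edge[OF assms(1)]
    unfolding gaps_def by auto
qed

lemma middle_or_base_apex:
  assumes full: "\<And>x y. x \<in> S \<Longrightarrow> y \<in> S \<Longrightarrow> x < y \<Longrightarrow> uncrossed C x y \<Longrightarrow> {x, y} \<in> C \<union> B"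
    and b: "b \<in> S" "0 < b" "b < m" "b \<notin> gaps S C"
  shows "middle C b \<or> {0, b} \<in> C \<and> {b, m} \<in> C"
proof -
  obtain p where p: "p < b" "{p, b} \<in> C" "\<And>w. w < p \<Longrightarrow> {w, b} \<notin> C"
    using lowest_neighbour b(1,2) by blast
  obtain r where r: "consecutive S b r" using successor_exists b(1,3) by blast
  then have "{b, r} \<in> C" "b < r" using b(4) by (auto simp: gaps_def consecutive_def)
  then obtain q where q: "b < q" "{b, q} \<in> C" "\<And>w. q < w \<Longrightarrow> {b, w} \<notin> C"
    using highest_neighbour by blast
  have pq_uncrossed: "uncrossed C p q"
    using p q by (intro uncrossed_extreme_neighbours[OF noncrossing_C, of p b]) auto
  have pq: "p \<in> S" "q \<in> S" using p q edgeD by blast+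
  show ?thesis
  proof (cases "{p, q} \<in> C")
    case True
    then show ?thesis using p q by (auto simp: middle_def triangle_def)
  next
    case False
    then have "{p, q} \<in> B" using full[OF pq _ pq_uncrossed] p q by auto
    then have "\<not> diagonal S p q" using uncrossed_diagonal_free pq_uncrossed by blast
    then have all: "p \<le> x \<and> x \<le> q" if "x \<in> S" for x
      using that pq b(1) p(1) q(1) by (auto simp: diagonal_def not_less)
    have "p = 0" "q = m" using all[OF zero_in_S] all[OF m_in_S] S_le_m[OF pq(2)] by auto
    then show ?thesis using p(2) q(2) by simp
  qed
qed

lemma base_apex_unique:
  assumes "b \<in> {0<..<m}" "{0, b} \<in> C" "{b, m} \<in> C" "b' \<in> {0<..<m}" "{0, b'} \<in> C" "{b', m} \<in> C"
  shows "b = b'"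
proof -
  have "\<not> interleaved 0 b b' m" "\<not> interleaved 0 b' b m"
    using noncrossingD[OF noncrossing_C] assms by blast+
  then show ?thesis using assms(1,4) by (auto simp: interleaved_def)
qed

lemma card_polygon_le_triangles:
  assumes full: "\<And>x y. x \<in> S \<Longrightarrow> y \<in> S \<Longrightarrow> x < y \<Longrightarrow> uncrossed C x y \<Longrightarrow> {x, y} \<in> C \<union> B"
  shows "card S \<le> triangles n C + card (gaps S C) + 3"
proof -
  define A where "A = {b \<in> {0<..<m}. {0, b} \<in> C \<and> {b, m} \<in> C}"
  have "finite A" by (simp add: A_def)
  moreover have "b = b'" if "b \<in> A" "b' \<in> A" for b b'
    using base_apex_unique that by (simp add: A_def)
  ultimately have "card A \<le> 1" by (metis One_nat_def card_le_Suc0_iff_eq)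
  have "S \<subseteq> {b. middle C b} \<union> (gaps S C \<union> (A \<union> {0, m}))"
  proof
    fix b assume "b \<in> S"
    then show "b \<in> {b. middle C b} \<union> (gaps S C \<union> (A \<union> {0, m}))"
      using middle_or_base_apex[OF full, of b] S_le_m[of b] by (fastforce simp: A_def)
  qed
  moreover have "finite {b. middle C b}"
    by (rule finite_subset[of _ "{..<n}"]) (use middle_less[OF C_subset_edges] in auto)
  ultimately have "card S \<le> card ({b. middle C b} \<union> (gaps S C \<union> (A \<union> {0, m})))"
    using finite_gaps \<open>finite A\<close> by (intro card_mono) auto
  also have "\<dots> \<le> card {b. middle C b} + (card (gaps S C) + (card A + card {0, m}))"
    by (meson add_left_mono card_Un_le order_trans)
  also have "\<dots> \<le> triangles n C + card (gaps S C) + 3"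
    using triangles_eq_card_middle[OF C_subset_edges noncrossing_C] \<open>card A \<le> 1\<close> m_pos by simp
  finally show ?thesis .
qed

end

section \<open>Constructor's credit\<close>

definition fresh :: "nat \<Rightarrow> nat \<Rightarrow> nat set \<Rightarrow> nat set \<Rightarrow> nat set set \<Rightarrow> bool" where
  "fresh n m S F B \<longleftrightarrow> F \<subseteq> {m<..<n} \<and> (\<forall>z\<in>F. \<forall>x\<in>S \<union> F. {x, z} \<notin> B)"

lemma finite_fresh: "fresh n m S F B \<Longrightarrow> finite F"
  unfolding fresh_def by (meson finite_greaterThanLessThan finite_subset)

definition top_gap_open :: "nat \<Rightarrow> nat set \<Rightarrow> nat set set \<Rightarrow> nat set set \<Rightarrow> bool" where
  "top_gap_open m S C B \<longleftrightarrow> (\<exists>l. consecutive S l m \<and> {l, m} \<notin> C \<and> {l, m} \<notin> B)"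

definition surplus :: "nat set \<Rightarrow> nat set \<Rightarrow> nat set set \<Rightarrow> int" where
  "surplus S F C = int (card F) + 2 * int (card S) - 2 * int (card (gaps S C))"

definition credit :: "nat \<Rightarrow> nat set \<Rightarrow> nat set \<Rightarrow> nat set set \<Rightarrow> nat set set \<Rightarrow> int" where
  "credit m S F C B = surplus S F C + of_bool ({0, m} \<notin> B) + of_bool (top_gap_open m S C B)"

text \<open>The reserve \<open>s\<close> is \<open>2\<close> when Constructor is to move and \<open>3\<close> when Blocker is to move. Without
  fresh vertices \<open>S\<close> no longer grows and only has to be triangulated, so no reserve is needed.\<close>
definition solvent :: "nat \<Rightarrow> nat \<Rightarrow> nat \<Rightarrow> nat set \<Rightarrow> nat set \<Rightarrow> nat set set \<Rightarrow> nat set set \<Rightarrow> bool" where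
  "solvent n s m S F C B \<longleftrightarrow>
     int (n + s) \<le> credit m S F C B \<or> F = {} \<and> int n \<le> surplus S F C"

lemma solvent_without_fresh: "solvent n s m S {} C B \<Longrightarrow> 2 \<le> s \<Longrightarrow> int n \<le> surplus S {} C"
  unfolding solvent_def credit_def by (auto simp: of_bool_def split: if_splits)

definition Constructor_ahead :: "nat \<Rightarrow> nat set set \<Rightarrow> nat set set \<Rightarrow> bool" where
  "Constructor_ahead n C B \<longleftrightarrow>
     (\<exists>m S F. polygon n m S C B \<and> fresh n m S F B \<and> solvent n 3 m S F C B)"

definition Constructor_reply :: "nat \<Rightarrow> nat set set \<Rightarrow> nat set set \<Rightarrow> bool" where
  "Constructor_reply n C B \<longleftrightarrow>
     n \<le> 2 * triangles n C + 6 \<or> (\<exists>e\<in>legalC n C B. Constructor_ahead n (insert e C) B)"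

context polygon
begin

lemma legal_inside:
  assumes "x \<in> S" "y \<in> S" "x < y" "uncrossed C x y" "{x, y} \<notin> C" "{x, y} \<notin> B"
  shows "{x, y} \<in> legalC n C B"
  using assms S_less_n by (simp add: pair_in_legalC_iff[OF C_subset_edges])

lemma fresh_disjoint_S: "fresh n m S F B \<Longrightarrow> z \<in> F \<Longrightarrow> z \<notin> S"
  using S_le_m by (force simp: fresh_def)

lemma base_neq_diagonal: "diagonal S a b \<Longrightarrow> {0, m} \<noteq> {a, b}"
  using S_le_m by (fastforce simp: diagonal_def doubleton_eq_iff)

lemma credit_insert_diagonals:
  assumes "diagonal S x y" "diagonal S a b"
  shows "credit m S F (insert {x, y} C) (insert {a, b} B) = credit m S F C B"
proof -
  have "{l, m} \<noteq> {x, y}" "{l, m} \<noteq> {a, b}" if "consecutive S l m" for l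
    using consecutive_neq_diagonal[OF that] assms by simp_all
  then have "top_gap_open m S (insert {x, y} C) (insert {a, b} B) \<longleftrightarrow> top_gap_open m S C B"
    unfolding top_gap_open_def insert_iff by meson
  moreover have "{0, m} \<in> insert {a, b} B \<longleftrightarrow> {0, m} \<in> B"
    using base_neq_diagonal[OF assms(2)] by blast
  ultimately show ?thesis
    by (simp only: credit_def surplus_def gaps_insert_diagonal[OF assms(1)])
qed

lemma credit_fill_top_gap:
  assumes gap: "consecutive S l m" "{l, m} \<notin> C" "{l, m} \<notin> B"
  shows "credit m S F (insert {l, m} C) B = credit m S F C B + 1"
proof -
  have "l \<in> gaps S C" using gap by (auto simp: gaps_def)
  then have "card (gaps S C) = Suc (card (gaps S (insert {l, m} C)))"
    unfolding gaps_insert_consecutive[OF gap(1)] using finite_gaps by (metis card.remove)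
  moreover have "top_gap_open m S C B" using gap by (auto simp: top_gap_open_def)
  moreover have "\<not> top_gap_open m S (insert {l, m} C) B"
    using consecutive_unique(2)[OF gap(1)] by (auto simp: top_gap_open_def)
  ultimately show ?thesis by (simp add: credit_def surplus_def)
qed

lemma surplus_insert_top:
  assumes "fresh n m S F B" "z \<in> F"
  shows "surplus (insert z S) (F - {z}) C' = surplus S F C + 1
    + 2 * int (card (gaps S C)) - 2 * int (card (gaps (insert z S) C'))"
proof -
  have "card F = Suc (card (F - {z}))"
    using card.remove[OF finite_fresh[OF assms(1)] assms(2)] by simp
  moreover have "card (insert z S) = Suc (card S)"
    using finite_S fresh_disjoint_S[OF assms] by simp
  ultimately show ?thesis by (simp add: surplus_def)
qed

lemma credit_insert_top_side:
  assumes F: "fresh n m S F B" "z \<in> F" and "{0, m} \<notin> B" "\<not> top_gap_open m S C B"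
  shows "credit z (insert z S) (F - {z}) (insert {m, z} C) B = credit m S F C B + 1"
proof -
  have z: "m < z" "{0, z} \<notin> B" using F zero_in_S by (auto simp: fresh_def)
  have "\<not> top_gap_open z (insert z S) (insert {m, z} C) B"
    using S_le_m z(1) unfolding top_gap_open_def consecutive_insert_top[OF z(1)]
    by (fastforce simp: consecutive_def)
  then show ?thesis
    using assms(3,4) z(2)
    by (simp add: credit_def surplus_insert_top[OF F] gaps_insert_top_side[OF z(1)])
qed

lemma credit_insert_top_fan:
  assumes F: "fresh n m S F B" "z \<in> F" and "{0, m} \<in> B" "\<not> top_gap_open m S C B" "q < m"
  shows "credit z (insert z S) (F - {z}) (insert {q, z} C) B = credit m S F C B + 1"
proof -
  have z: "m < z" "{0, z} \<notin> B" "{m, z} \<notin> B"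
    using F zero_in_S m_in_S by (auto simp: fresh_def)
  have "{m, z} \<notin> insert {q, z} C"
    using edge_above_m_notin_C[OF z(1)] z(1) \<open>q < m\<close> by (auto simp: doubleton_eq_iff)
  then have "top_gap_open z (insert z S) (insert {q, z} C) B"
    using z(3) unfolding top_gap_open_def consecutive_insert_top[OF z(1)] by blast
  moreover have "card (insert m (gaps S C)) = Suc (card (gaps S C))"
    using m_notin_gaps finite_gaps by simp
  ultimately show ?thesis
    using assms(3,4) z(2)
    by (simp add: credit_def surplus_insert_top[OF F] gaps_insert_top_fan[OF z(1) \<open>q < m\<close>])
qed

lemma fresh_credit_insert_Blocker_inside:
  assumes F: "fresh n m S F B" and uv: "u \<in> S" "v \<in> S"
  shows "fresh n m S F (insert {u, v} B)"
    and "credit m S F C B \<le> credit m S F C (insert {u, v} B) + 1"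
proof -
  show "fresh n m S F (insert {u, v} B)"
    using F uv fresh_disjoint_S[OF F] unfolding fresh_def by (auto simp: doubleton_eq_iff)
  show "credit m S F C B \<le> credit m S F C (insert {u, v} B) + 1"
  proof (cases "{0, m} = {u, v}")
    case True
    have "l \<noteq> 0" if "consecutive S l m" "{l, m} \<notin> C" for l using spanned[OF that(1)] that(2) by auto
    then have "top_gap_open m S C (insert {u, v} B) \<longleftrightarrow> top_gap_open m S C B"
      unfolding top_gap_open_def True[symmetric] by (auto simp: doubleton_eq_iff)
    then show ?thesis by (simp add: credit_def of_bool_def)
  next
    case False
    then show ?thesis by (simp add: credit_def of_bool_def)
  qed
qed

lemma fresh_credit_insert_Blocker_outside:
  assumes F: "fresh n m S F B" and uv: "u \<noteq> v" "\<not> (u \<in> S \<and> v \<in> S)"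
  obtains w where "fresh n m S (F - {w}) (insert {u, v} B)"
    "credit m S F C B \<le> credit m S (F - {w}) C (insert {u, v} B) + 1"
proof
  define w where "w = (if u \<in> F then u else v)"
  show "fresh n m S (F - {w}) (insert {u, v} B)"
    using F uv(1) fresh_disjoint_S[OF F] unfolding fresh_def w_def by (auto simp: doubleton_eq_iff)
  have "{x, m} \<noteq> {u, v}" if "x \<in> S" for x using that m_in_S uv(2) by (auto simp: doubleton_eq_iff)
  then have "top_gap_open m S C (insert {u, v} B) \<longleftrightarrow> top_gap_open m S C B"
    "{0, m} \<in> insert {u, v} B \<longleftrightarrow> {0, m} \<in> B"
    using zero_in_S by (auto simp: top_gap_open_def consecutive_def)
  moreover have "card F \<le> Suc (card (F - {w}))"
    using diff_card_le_card_Diff[of "{w}" F] by simp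
  ultimately show "credit m S F C B \<le> credit m S (F - {w}) C (insert {u, v} B) + 1"
    by (simp add: credit_def surplus_def)
qed

lemma fresh_solvent_insert_Blocker:
  assumes "fresh n m S F B" "u \<noteq> v" "solvent n 3 m S F C B"
  obtains F' where "fresh n m S F' (insert {u, v} B)" "solvent n 2 m S F' C (insert {u, v} B)"
proof -
  obtain F' where F': "fresh n m S F' (insert {u, v} B)" "F' \<subseteq> F"
    and credit: "credit m S F C B \<le> credit m S F' C (insert {u, v} B) + 1"
  proof (cases "u \<in> S \<and> v \<in> S")
    case True
    then show ?thesis using that fresh_credit_insert_Blocker_inside[OF assms(1)] by blast
  next
    case False
    then show ?thesis
      using that fresh_credit_insert_Blocker_outside[OF assms(1,2)] by (metis Diff_subset)
  qed
  have "solvent n 2 m S F' C (insert {u, v} B)"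
  proof (cases "F = {}")
    case True
    then show ?thesis
      using F'(2) solvent_without_fresh[of n 3 m S C B] assms(3) by (simp add: solvent_def)
  next
    case False
    then show ?thesis using assms(3) credit by (simp add: solvent_def)
  qed
  then show ?thesis using that F'(1) by blast
qed

lemma reply_triangulate:
  assumes "int n \<le> surplus S {} C"
  shows "Constructor_reply n C B"
proof (cases "\<exists>x y. x \<in> S \<and> y \<in> S \<and> x < y \<and> uncrossed C x y \<and> {x, y} \<notin> C \<union> B")
  case True
  then obtain x y where xy: "x \<in> S" "y \<in> S" "x < y" "uncrossed C x y" "{x, y} \<notin> C" "{x, y} \<notin> B"
    by blast
  have "card (gaps S (insert {x, y} C)) \<le> card (gaps S C)"
    by (rule card_mono[OF finite_gaps]) (auto simp: gaps_def)
  then have "int n \<le> surplus S {} (insert {x, y} C)" using assms by (simp add: surplus_def)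
  then have "Constructor_ahead n (insert {x, y} C) B"
    using insert_Constructor[OF xy(1-4,6)]
    unfolding Constructor_ahead_def solvent_def fresh_def by blast
  then show ?thesis using legal_inside[OF xy] unfolding Constructor_reply_def by blast
next
  case False
  then have "card S \<le> triangles n C + card (gaps S C) + 3"
    by (intro card_polygon_le_triangles) blast
  then show ?thesis using assms unfolding Constructor_reply_def surplus_def by simp
qed

lemma reply_fill_top_gap:
  assumes "fresh n m S F B" "top_gap_open m S C B" "int (n + 2) \<le> credit m S F C B"
  shows "Constructor_reply n C B"
proof -
  obtain l where gap: "consecutive S l m" "{l, m} \<notin> C" "{l, m} \<notin> B"
    using assms(2) by (auto simp: top_gap_open_def)
  then have l: "l \<in> S" "l < m" by (auto simp: consecutive_def)
  have uncrossed: "uncrossed C l m"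
    using gap(1) S_le_m edgeD unfolding uncrossed_def interleaved_def consecutive_def by fastforce
  have "solvent n 3 m S F (insert {l, m} C) B"
    using assms(3) by (simp add: solvent_def credit_fill_top_gap[OF gap])
  then have "Constructor_ahead n (insert {l, m} C) B"
    using insert_Constructor[OF l(1) m_in_S l(2) uncrossed gap(3)] assms(1)
    unfolding Constructor_ahead_def by blast
  then show ?thesis
    using legal_inside[OF l(1) m_in_S l(2) uncrossed gap(2,3)]
    unfolding Constructor_reply_def by blast
qed

lemma reply_insert_top:
  assumes F: "fresh n m S F B" "F \<noteq> {}"
    and q: "q \<in> S" "q = m \<or> {q, m} \<in> C" "\<And>z. m < z \<Longrightarrow> uncrossed C q z"
    and base: "\<And>z. m < z \<Longrightarrow> uncrossed (insert {q, z} C) 0 m \<Longrightarrow> {0, m} \<notin> B"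
    and credit: "\<And>z. z \<in> F \<Longrightarrow>
      int (n + 3) \<le> credit z (insert z S) (F - {z}) (insert {q, z} C) B"
  shows "Constructor_reply n C B"
proof -
  define z where "z = Min F"
  have z: "z \<in> F" using Min_in[OF finite_fresh[OF F(1)] F(2)] by (simp add: z_def)
  have "z \<le> w" if "w \<in> F" for w using Min_le[OF finite_fresh[OF F(1)] that] by (simp add: z_def)
  then have "F - {z} \<subseteq> {z<..<n}" using F(1) unfolding fresh_def by force
  then have fresh: "fresh n z (insert z S) (F - {z}) B" using F(1) z unfolding fresh_def by blast
  have free: "m < z" "z < n" "\<And>x. x \<in> S \<Longrightarrow> {x, z} \<notin> B" using F(1) z by (auto simp: fresh_def)
  then have "{q, z} \<in> legalC n C B"
    using q S_le_m[OF q(1)] edge_above_m_notin_C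
    by (subst pair_in_legalC_iff[OF C_subset_edges]) auto
  moreover have "polygon n z (insert z S) (insert {q, z} C) B"
    using free q base by (intro insert_top) auto
  ultimately show ?thesis
    using fresh credit[OF z]
    unfolding Constructor_reply_def Constructor_ahead_def solvent_def by blast
qed

lemma reply_side:
  assumes F: "fresh n m S F B" "F \<noteq> {}" and "{0, m} \<notin> B" "\<not> top_gap_open m S C B"
    and "int (n + 2) \<le> credit m S F C B"
  shows "Constructor_reply n C B"
proof (rule reply_insert_top[OF F m_in_S])
  show "uncrossed C m z" if "m < z" for z
    using edgeD S_le_m unfolding uncrossed_def interleaved_def by fastforce
  show "int (n + 3) \<le> credit z (insert z S) (F - {z}) (insert {m, z} C) B" if "z \<in> F" for z
    using credit_insert_top_side[OF F(1) that assms(3,4)] assms(5) by simp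
qed (use assms(3) in auto)

lemma reply_fan:
  assumes F: "fresh n m S F B" "F \<noteq> {}" and "{0, m} \<in> B" "\<not> top_gap_open m S C B"
    and "int (n + 2) \<le> credit m S F C B"
  shows "Constructor_reply n C B"
proof -
  obtain q where q: "q < m" "{q, m} \<in> C" "\<And>w. w < q \<Longrightarrow> {w, m} \<notin> C"
    using lowest_neighbour[OF m_in_S m_pos] by blast
  then have "q \<in> S" using edgeD by blast
  show ?thesis
  proof (rule reply_insert_top[OF F \<open>q \<in> S\<close>])
    show "q = m \<or> {q, m} \<in> C" using q(2) by simp
    show "uncrossed C q z" if "m < z" for z
      unfolding uncrossed_def
    proof (intro allI impI)
      fix c d assume cd: "{c, d} \<in> C"
      then have "c \<le> m" "d \<le> m" using edgeD S_le_m by blast+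
      moreover have "\<not> interleaved q m c d" using noncrossingD[OF noncrossing_C q(2) cd] .
      moreover have "\<not> (d = m \<and> c < q)" using q(3) cd by blast
      ultimately show "\<not> interleaved q z c d" using that by (auto simp: interleaved_def)
    qed
    have "q \<noteq> 0" using q(2) assms(3) C_B_disjoint by (metis disjoint_iff)
    then show "{0, m} \<notin> B" if "m < z" "uncrossed (insert {q, z} C) 0 m" for z
      using that q(1) uncrossed_insert_iff[of q z C 0 m] by (simp add: interleaved_def)
    show "int (n + 3) \<le> credit z (insert z S) (F - {z}) (insert {q, z} C) B" if "z \<in> F" for z
      using credit_insert_top_fan[OF F(1) that assms(3,4) q(1)] assms(5) by simp
  qed
qed

lemma reply_if_solvent:
  assumes F: "fresh n m S F B" and solvent: "solvent n 2 m S F C B"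
  shows "Constructor_reply n C B"
proof (cases "F = {}")
  case True
  then show ?thesis using reply_triangulate solvent_without_fresh[of n 2] solvent by simp
next
  case False
  then have "int (n + 2) \<le> credit m S F C B" using solvent by (simp add: solvent_def)
  then show ?thesis
    using reply_fill_top_gap[OF F] reply_side[OF F False] reply_fan[OF F False] by blast
qed

lemma reply_cross_diagonal:
  assumes F: "fresh n m S F B" and solvent: "solvent n 3 m S F C B"
    and ab: "diagonal S a b" "uncrossed C a b" "{a, b} \<notin> C"
  shows "Constructor_reply n C (insert {a, b} B)"
proof -
  obtain x y where xy: "diagonal S x y" "uncrossed C x y" and inter: "interleaved a b x y"
    using crossing_diagonal[OF ab] by blast
  have S: "a \<in> S" "b \<in> S" "x \<in> S" "y \<in> S" "x < y"
    using ab(1) xy(1) by (auto simp: diagonal_def)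
  have "{x, y} \<noteq> {a, b}" using inter by (auto simp: interleaved_def doubleton_eq_iff)
  have "{x, y} \<notin> C" using ab(2) inter unfolding uncrossed_def by blast
  have "{x, y} \<notin> B" using uncrossed_diagonal_free[OF xy] .
  interpret crossed: polygon n m S "insert {x, y} C" B
    using insert_Constructor[OF S(3-5) xy(2) \<open>{x, y} \<notin> B\<close>] .
  have "\<not> uncrossed (insert {x, y} C) a b"
    using inter by (simp add: uncrossed_insert_iff[OF \<open>x < y\<close>])
  then have "polygon n m S (insert {x, y} C) (insert {a, b} B)"
    using ab(3) \<open>{x, y} \<noteq> {a, b}\<close> diagonal_less[OF ab(1)] by (intro crossed.insert_Blocker) auto
  moreover have "fresh n m S F (insert {a, b} B)"
    using fresh_credit_insert_Blocker_inside(1)[OF F S(1,2)] .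
  moreover have "solvent n 3 m S F (insert {x, y} C) (insert {a, b} B)"
    using solvent by (simp add: solvent_def credit_insert_diagonals[OF xy(1) ab(1)]
        surplus_def gaps_insert_diagonal[OF xy(1)])
  ultimately have "Constructor_ahead n (insert {x, y} C) (insert {a, b} B)"
    unfolding Constructor_ahead_def by blast
  moreover have "{x, y} \<in> legalC n C (insert {a, b} B)"
    using legal_inside[OF S(3-5) xy(2)] \<open>{x, y} \<notin> C\<close> \<open>{x, y} \<notin> B\<close> \<open>{x, y} \<noteq> {a, b}\<close>
    by (simp add: legalC_def)
  ultimately show ?thesis unfolding Constructor_reply_def by blast
qed

end

lemma Constructor_reply_if_ahead:
  assumes "Constructor_ahead n C B" shows "Constructor_reply n C B"
proof -
  obtain m S F where "polygon n m S C B" and F: "fresh n m S F B" "solvent n 3 m S F C B"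
    using assms by (auto simp: Constructor_ahead_def)
  then interpret polygon n m S C B by simp
  have "solvent n 2 m S F C B" using F(2) by (auto simp: solvent_def)
  then show ?thesis by (rule reply_if_solvent[OF F(1)])
qed

lemma Constructor_reply_to_Blocker:
  assumes "Constructor_ahead n C B" "f \<in> unclaimed n C B"
  shows "Constructor_reply n C (insert f B)"
proof -
  obtain m S F where "polygon n m S C B" and F: "fresh n m S F B" "solvent n 3 m S F C B"
    using assms(1) by (auto simp: Constructor_ahead_def)
  then interpret polygon n m S C B by simp
  obtain u v where f: "f = {u, v}" "u < v" and "{u, v} \<notin> C"
    using assms(2) by (auto simp: unclaimed_def elim: ecb_edgesE)
  show ?thesis
  proof (cases "diagonal S u v \<and> uncrossed C u v")
    case True
    then show ?thesis unfolding f(1) using reply_cross_diagonal[OF F] \<open>{u, v} \<notin> C\<close> by blast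
  next
    case False
    then have "polygon n m S C (insert f B)"
      unfolding f(1) using f(2) \<open>{u, v} \<notin> C\<close> by (intro insert_Blocker) auto
    then interpret blocked: polygon n m S C "insert f B" .
    obtain F' where "fresh n m S F' (insert f B)" "solvent n 2 m S F' C (insert f B)"
      using fresh_solvent_insert_Blocker[OF F(1) _ F(2), of u v] f by blast
    then show ?thesis by (rule blocked.reply_if_solvent)
  qed
qed

lemma Constructor_ahead_start:
  assumes "2 \<le> n" shows "Constructor_ahead n {{0, 1}} {}"
proof -
  have "polygon n 1 {0, 1} {{0, 1}} {}"
    by unfold_locales (use assms in \<open>auto simp: noncrossing_def uncrossed_def interleaved_def
      consecutive_def doubleton_eq_iff\<close>)
  moreover have "fresh n 1 {0, 1} {1<..<n} {}" by (simp add: fresh_def)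
  moreover have "gaps {0, 1} {{0, 1 :: nat}} = {}" by (auto simp: gaps_def consecutive_def)
  then have "solvent n 3 1 {0, 1} {1<..<n} {{0, 1}} {}"
    using assms by (simp add: solvent_def credit_def surplus_def)
  ultimately show ?thesis unfolding Constructor_ahead_def by blast
qed

lemma triangles_insert: "triangles n C \<le> triangles n (insert e C)"
  unfolding triangles_def by (rule card_mono) (auto intro: finite_subset[of _ "Pow {..<n}"])

definition Constructor_invariant :: "nat \<Rightarrow> bool \<Rightarrow> nat set set \<Rightarrow> nat set set \<Rightarrow> bool" where
  "Constructor_invariant n t C B \<longleftrightarrow> n \<le> 2 * triangles n C + 6 \<or>
     (if t then Constructor_reply n C B else Constructor_ahead n C B)"

lemma g_ECB_K3_lower: "n \<le> 2 * g_ECB_K3 n + 6"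
proof (cases "2 \<le> n")
  case True
  have "(n - 5) div 2 \<le> ecb_value n True {} {}"
  proof (rule ecb_value_ge_by_Constructor_strategy[of "Constructor_invariant n"])
    have "{0, 1} \<in> legalC n {} {}"
      using True by (subst pair_in_legalC_iff) (auto simp: uncrossed_def)
    then show "Constructor_invariant n True {} {}"
      using Constructor_ahead_start[OF True]
      by (auto simp: Constructor_invariant_def Constructor_reply_def)
  next
    fix t C B assume "Constructor_invariant n t C B" and "legalC n C B = {}"
    then have "n \<le> 2 * triangles n C + 6"
      using Constructor_reply_if_ahead unfolding Constructor_invariant_def Constructor_reply_def
      by (metis empty_iff)
    then show "(n - 5) div 2 \<le> triangles n C" by simp
  next
    fix C B assume inv: "Constructor_invariant n True C B" and "legalC n C B \<noteq> {}"
    then obtain e where e: "e \<in> legalC n C B" by blast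
    show "\<exists>e\<in>legalC n C B. Constructor_invariant n False (insert e C) B"
    proof (cases "n \<le> 2 * triangles n C + 6")
      case True
      then have "n \<le> 2 * triangles n (insert e C) + 6" using triangles_insert[of n C e] by linarith
      then show ?thesis using e unfolding Constructor_invariant_def by blast
    next
      case False
      then show ?thesis
        using inv unfolding Constructor_invariant_def Constructor_reply_def
        by (simp only: if_True if_False) blast
    qed
  next
    fix C B f assume "Constructor_invariant n False C B" and "f \<in> unclaimed n C B"
    then show "Constructor_invariant n True C (insert f B)"
      using Constructor_reply_to_Blocker unfolding Constructor_invariant_def by auto
  qed
  then show ?thesis unfolding g_ECB_K3_eq by linarith
qed simp

theorem theorem1p7:
  shows "\<forall>\<epsilon>>0. \<forall>\<^sub>F n in sequentially.
     (1 - \<epsilon>) * (real n / 2) \<le> real (g_ECB_K3 n) \<and>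
     real (g_ECB_K3 n) \<le> (1 + \<epsilon>) * (2 * real n / 3)"
proof (intro allI impI)
  fix \<epsilon> :: real assume "\<epsilon> > 0"
  have "\<forall>\<^sub>F n in sequentially. 6 / \<epsilon> \<le> real n"
    by (rule eventually_compose_filterlim[OF eventually_ge_at_top filterlim_real_sequentially])
  then show "\<forall>\<^sub>F n in sequentially. (1 - \<epsilon>) * (real n / 2) \<le> real (g_ECB_K3 n) \<and>
     real (g_ECB_K3 n) \<le> (1 + \<epsilon>) * (2 * real n / 3)"
  proof eventually_elim
    case (elim n)
    then have "6 \<le> \<epsilon> * real n" using \<open>\<epsilon> > 0\<close> by (simp add: field_simps)
    moreover have "real n \<le> 2 * real (g_ECB_K3 n) + 6" "3 * real (g_ECB_K3 n) \<le> 2 * real n + 2"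
      using g_ECB_K3_lower[of n] g_ECB_K3_upper[of n] by linarith+
    ultimately show ?case by (simp add: algebra_simps)
  qed
qed

end
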